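(* Let $\Lambda$ be a finitely generated semigroup as in the context, let $R$ be $\mathbf C[\Lambda]$ or $\mathbf C[[\Lambda]]$, and let $\underline\nu=(\nu_1,\dots,\nu_r)$ be a sequence of monomial valuations of $R$, corresponding to a sequence $\underline v=(v_1,\dots,v_r)$ of non-zero vectors of $\sigma\cap N$. Then these valuations induce a multi-graded ring $\mathrm{gr}_{\underline\nu}R$ together with a sequence of valuations $\underline{\bar\nu}=(\bar\nu_1,\dots,\bar\nu_r)$ on it, and there exists an isomorphism of graded rings $$\psi:\mathrm{gr}_{\underline\nu}R\to\mathbf C[\Lambda]^{(\underline v)}$$ such that $\nu_i\circ\psi=\bar\nu_i$ for $i=1,\dots,r$.
   Context: $\Lambda$ is a finitely generated sub-semigroup (with $0$) of a rank $d$ lattice $M=\Lambda+(-\Lambda)$; $N$ is the dual lattice; $\sigma\subset N_{\mathbf R}$ is the cone whose dual is $\sigma^\vee=\mathbf R_{\ge0}\Lambda$, and $\sigma^\vee$ is assumed to have a vertex (i.e. $\mathrm{Spec}\,\mathbf C[\Lambda]$ has a zero-dimensional orbit). A non-zero $v\in\sigma\cap N$ defines the monomial valuation $\nu(\sum c_uX^u)=\min_{c_u\ne0}\langle v,u\rangle$ of $\mathbf C[\Lambda]$ and $\mathbf C[[\Lambda]]$. $\mathbf C[\Lambda]^{(\underline v)}$ is $\mathbf C[\Lambda]$ with the $\mathbf Z^r_{\ge0}$-grading with components $H(\underline a)=\bigoplus_{u\in\Lambda,\ \langle v_j,u\rangle=a_j,\ j=1,\dots,r}\mathbf CX^u$.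 **Graded ring of a valuation, compatibility, induced valuations.** For a (multi-graded) ring $A$ and a discrete valuation $\nu$ non-negative on $A$, put $I(b)=\{\phi\in A:\nu(\phi)\ge b\}$ and $\mathrm{gr}_\nu A=\bigoplus_{b\ge0}I(b)/I(b+1)$. If $A=\bigoplus_{\underline a}J(\underline a)$, $\nu$ is compatible with the grading if all $I(b)$ are homogeneous; then $\mathrm{gr}_\nu A$ is multi-graded with components $J(\underline a,b)=I(\underline a,b)/I(\underline a,b+1)$, $I(\underline a,b)=I(b)\cap J(\underline a)$. Another valuation $\omega$ on $A$ induces $\bar\omega$ on $\mathrm{gr}_\nu A$: for a non-zero homogeneous $\bar h$ of $\nu$-degree $b$ (and of given multidegree, if $A$ is multi-graded), $\bar\omega(\bar h)=\max\{\omega(h):h+I(b+1)=\bar h\}$, and on a sum of non-zero homogeneous terms $\bar\omega$ is the minimum of the values. $\mathrm{gr}_{\underline\nu}R$ with $\underline{\bar\nu}$ is obtained by iterating: from $\mathrm{gr}_{(\nu_1,\dots,\nu_k)}R$ with its induced maps $\tilde\nu_1,\dots,\tilde\nu_r$, take the graded ring associated with $\tilde\nu_{k+1}$ and the maps induced on it, for $k=1,\dots,r-1$, starting with $\mathrm{gr}_{\nu_1}R$; the assertion includes that at each step these maps are valuations compatible with the grading.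
   Formalization: For R = C[[Λ]] the isomorphism ψ is asserted only if no non-zero u in Λ is orthogonal to all v_j; otherwise it fails (e.g. Λ = N², v = (1,0): degree-0 parts C[[y]] and C[y]). The claim on induced valuations and gradings is kept in full for both rings. *)

theory Defs
  imports "HOL-Analysis.Analysis" "HOL-Algebra.QuotRing"
begin

section \<open>Semigroups in a lattice\<close>

text \<open>
  The rank \<open>d\<close> lattice \<open>M\<close> is \<open>int ^ 'd\<close> with \<open>d = CARD('d)\<close>; its dual lattice \<open>N\<close> is
  \<open>int ^ 'd\<close> as well, through \<^term>\<open>pairing\<close>. Correspondingly the real vector spaces spanned by
  \<open>M\<close> and \<open>N\<close> are both \<open>real ^ 'd\<close>, and the pairing is the inner product.
\<close>

definition pairing :: "int ^ 'd \<Rightarrow> int ^ 'd \<Rightarrow> int" where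
  "pairing v u = (\<Sum>i\<in>UNIV. v $ i * u $ i)"

definition real_vec :: "int ^ 'd \<Rightarrow> real ^ 'd" where
  "real_vec u = (\<chi> i. real_of_int (u $ i))"

definition submonoid :: "'a::monoid_add set \<Rightarrow> bool" where
  "submonoid S \<longleftrightarrow> 0 \<in> S \<and> (\<forall>x\<in>S. \<forall>y\<in>S. x + y \<in> S)"

definition fin_gen_submonoid :: "'a::monoid_add set \<Rightarrow> bool" where
  "fin_gen_submonoid S \<longleftrightarrow> (\<exists>F. finite F \<and> S = submonoid hull F)"

definition dual_cone :: "(real ^ 'd) set \<Rightarrow> (real ^ 'd) set" where
  "dual_cone C = {x. \<forall>n\<in>C. 0 \<le> n \<bullet> x}"


section \<open>Semigroup algebra, formal power series, monomial valuations\<close>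

text \<open>
  An element \<open>\<Sum> c\<^sub>u X\<^sup>u\<close> is its coefficient function \<open>c\<close>. The sum in \<open>convol\<close> is finite for
  finitely supported functions, and also for arbitrary functions supported in a finitely generated
  semigroup \<open>\<Lambda>\<close> whose cone has a vertex: then every \<open>u\<close> is a sum of two elements of \<open>\<Lambda>\<close>
  in only finitely many ways.
\<close>

definition convol :: "('a::monoid_add \<Rightarrow> complex) \<Rightarrow> ('a \<Rightarrow> complex) \<Rightarrow> 'a \<Rightarrow> complex" where
  "convol f g u = (\<Sum>(a, b)\<in>{(a, b). f a \<noteq> 0 \<and> g b \<noteq> 0 \<and> a + b = u}. f a * g b)"

definition semigroup_series :: "'a::monoid_add set \<Rightarrow> ('a \<Rightarrow> complex) ring" where
  "semigroup_series \<Lambda> =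
     \<lparr> carrier = {f. \<forall>u. f u \<noteq> 0 \<longrightarrow> u \<in> \<Lambda>},
       mult = convol,
       one = (\<lambda>u. if u = 0 then 1 else 0),
       zero = (\<lambda>u. 0),
       add = (\<lambda>f g u. f u + g u) \<rparr>"

definition semigroup_algebra :: "'a::monoid_add set \<Rightarrow> ('a \<Rightarrow> complex) ring" where
  "semigroup_algebra \<Lambda> = (semigroup_series \<Lambda>)
     \<lparr> carrier := {f. (\<forall>u. f u \<noteq> 0 \<longrightarrow> u \<in> \<Lambda>) \<and> finite {u. f u \<noteq> 0}} \<rparr>"

text \<open>
  For \<open>v\<close> in the cone \<open>\<sigma>\<close> all the values \<^term>\<open>pairing v u\<close> occurring here are non-negative, so
  \<^term>\<open>nat\<close> truncates nothing. A non-empty infimum in \<^typ>\<open>enat\<close> is a minimum; the empty one,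
  for \<open>f = 0\<close>, is infinity.
\<close>

definition monomial_val :: "int ^ 'd \<Rightarrow> (int ^ 'd \<Rightarrow> complex) \<Rightarrow> enat" where
  "monomial_val v f = (INF u\<in>{u. f u \<noteq> 0}. enat (nat (pairing v u)))"

text \<open>The component of multidegree \<open>a\<close> of the grading of the semigroup algebra given by
  a sequence of vectors.\<close>

definition monomial_comp ::
    "(int ^ 'd) set \<Rightarrow> (int ^ 'd) list \<Rightarrow> nat list \<Rightarrow> (int ^ 'd \<Rightarrow> complex) set" where
  "monomial_comp \<Lambda> vs a =
     {f \<in> carrier (semigroup_algebra \<Lambda>). \<forall>u. f u \<noteq> 0 \<longrightarrow> map (\<lambda>v. pairing v u) vs = map int a}"


section \<open>Multi-graded rings and valuations\<close>

text \<open>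
  A ring graded by \<open>k\<close>-tuples of natural numbers consists of a ring \<open>A\<close>, the number \<open>k\<close> and
  the components \<open>J a\<close>, which matter only for lists \<open>a\<close> of length \<open>k\<close>. A ring without grading
  is the case \<open>k = 0\<close>.
\<close>

definition is_decomp ::
    "('x, 'm) ring_scheme \<Rightarrow> nat \<Rightarrow> (nat list \<Rightarrow> 'x set) \<Rightarrow> 'x \<Rightarrow> (nat list \<Rightarrow> 'x) \<Rightarrow> bool" where
  "is_decomp A k J x f \<longleftrightarrow>
     (\<forall>a. length a = k \<longrightarrow> f a \<in> J a) \<and> (\<forall>a. length a \<noteq> k \<longrightarrow> f a = \<zero>\<^bsub>A\<^esub>) \<and>
     finite {a. f a \<noteq> \<zero>\<^bsub>A\<^esub>} \<and> x = finsum A f {a. f a \<noteq> \<zero>\<^bsub>A\<^esub>}"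

definition multigraded ::
    "('x, 'm) ring_scheme \<Rightarrow> nat \<Rightarrow> (nat list \<Rightarrow> 'x set) \<Rightarrow> bool" where
  "multigraded A k J \<longleftrightarrow>
     ring A \<and>
     (\<forall>a. length a = k \<longrightarrow> additive_subgroup (J a) A) \<and>
     (\<forall>a b. length a = k \<longrightarrow> length b = k \<longrightarrow>
        (\<forall>x\<in>J a. \<forall>y\<in>J b. x \<otimes>\<^bsub>A\<^esub> y \<in> J (map2 (+) a b))) \<and>
     (\<forall>x\<in>carrier A. \<exists>!f. is_decomp A k J x f)"

definition hom_part ::
    "('x, 'm) ring_scheme \<Rightarrow> nat \<Rightarrow> (nat list \<Rightarrow> 'x set) \<Rightarrow> 'x \<Rightarrow> nat list \<Rightarrow> 'x" where
  "hom_part A k J x = (THE f. is_decomp A k J x f)"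

text \<open>Valuations non-negative on the ring, with values in the natural numbers and infinity.\<close>

definition valuation :: "('x, 'm) ring_scheme \<Rightarrow> ('x \<Rightarrow> enat) \<Rightarrow> bool" where
  "valuation A \<nu> \<longleftrightarrow>
     domain A \<and>
     (\<forall>x\<in>carrier A. \<nu> x = \<infinity> \<longleftrightarrow> x = \<zero>\<^bsub>A\<^esub>) \<and>
     (\<forall>x\<in>carrier A. \<forall>y\<in>carrier A. \<nu> (x \<otimes>\<^bsub>A\<^esub> y) = \<nu> x + \<nu> y) \<and>
     (\<forall>x\<in>carrier A. \<forall>y\<in>carrier A. min (\<nu> x) (\<nu> y) \<le> \<nu> (x \<oplus>\<^bsub>A\<^esub> y))"

definition val_ideal :: "('x, 'm) ring_scheme \<Rightarrow> ('x \<Rightarrow> enat) \<Rightarrow> nat \<Rightarrow> 'x set" where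
  "val_ideal A \<nu> b = {x \<in> carrier A. enat b \<le> \<nu> x}"

definition compatible ::
    "('x, 'm) ring_scheme \<Rightarrow> nat \<Rightarrow> (nat list \<Rightarrow> 'x set) \<Rightarrow> ('x \<Rightarrow> enat) \<Rightarrow> bool" where
  "compatible A k J \<nu> \<longleftrightarrow>
     (\<forall>b. \<forall>x\<in>val_ideal A \<nu> b. \<forall>a. length a = k \<longrightarrow> hom_part A k J x a \<in> val_ideal A \<nu> b)"


section \<open>The graded ring of a valuation\<close>

text \<open>
  An element of \<open>\<Oplus>\<^sub>b I(b)/I(b+1)\<close> is the family of its components, each of which is a coset
  \<open>I(b+1) + h\<close> with \<open>h \<in> I(b)\<close>. As for the library's product of cosets, the degree \<open>b\<close> part of
  a product is described by a union over all choices of representatives, of cosets that all agree.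
\<close>

definition gr_ring :: "('x, 'm) ring_scheme \<Rightarrow> ('x \<Rightarrow> enat) \<Rightarrow> (nat \<Rightarrow> 'x set) ring" where
  "gr_ring A \<nu> = (let I = val_ideal A \<nu> in
     \<lparr> carrier = {x. (\<forall>b. \<exists>h\<in>I b. x b = I (Suc b) +>\<^bsub>A\<^esub> h) \<and> finite {b. x b \<noteq> I (Suc b)}},
       mult = (\<lambda>x y b. \<Union>h\<in>{h. \<forall>i. h i \<in> x i}. \<Union>g\<in>{g. \<forall>i. g i \<in> y i}.
                 I (Suc b) +>\<^bsub>A\<^esub> (finsum A (\<lambda>i. h i \<otimes>\<^bsub>A\<^esub> g (b - i)) {..b})),
       one = (\<lambda>b. if b = 0 then I (Suc 0) +>\<^bsub>A\<^esub> \<one>\<^bsub>A\<^esub> else I (Suc b)),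
       zero = (\<lambda>b. I (Suc b)),
       add = (\<lambda>x y b. set_add A (x b) (y b)) \<rparr>)"

text \<open>
  The component \<open>J(a,b) = I(a,b)/I(a,b+1)\<close>, where \<open>I(a,b) = I(b) \<inter> J(a)\<close>, regarded as a
  subgroup of \<open>I(b)/I(b+1)\<close>; its multidegree is the list \<open>a @ [b]\<close>.
\<close>

definition gr_comp ::
    "('x, 'm) ring_scheme \<Rightarrow> (nat list \<Rightarrow> 'x set) \<Rightarrow> ('x \<Rightarrow> enat) \<Rightarrow> nat list \<Rightarrow> (nat \<Rightarrow> 'x set) set" where
  "gr_comp A J \<nu> c =
     {(\<lambda>i. if i = last c then val_ideal A \<nu> (Suc i) +>\<^bsub>A\<^esub> h else val_ideal A \<nu> (Suc i)) |h.
        h \<in> val_ideal A \<nu> (last c) \<inter> J (butlast c)}"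

text \<open>
  The map induced by \<open>\<omega>\<close>: first on a homogeneous element \<open>y\<close> of multidegree \<open>c\<close>, then on sums
  of non-zero homogeneous terms. In \<^typ>\<open>enat\<close> a non-empty supremum is infinite unless it is an
  attained maximum. So the requirement that the induced map be a valuation, which makes it finite
  on non-zero elements, contains the existence of the maxima.
\<close>

definition induced_hom ::
    "('x, 'm) ring_scheme \<Rightarrow> ('x \<Rightarrow> enat) \<Rightarrow> ('x \<Rightarrow> enat) \<Rightarrow> nat list \<Rightarrow> (nat \<Rightarrow> 'x set) \<Rightarrow> enat" where
  "induced_hom A \<nu> \<omega> c y =
     Sup {\<omega> h |h. h \<in> carrier A \<and> val_ideal A \<nu> (Suc (last c)) +>\<^bsub>A\<^esub> h = y (last c)}"

definition induced_val ::
    "('x, 'm) ring_scheme \<Rightarrow> nat \<Rightarrow> (nat list \<Rightarrow> 'x set) \<Rightarrow> ('x \<Rightarrow> enat) \<Rightarrow> ('x \<Rightarrow> enat) \<Rightarrow>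
      (nat \<Rightarrow> 'x set) \<Rightarrow> enat" where
  "induced_val A k J \<nu> \<omega> x =
     (let part = hom_part (gr_ring A \<nu>) (Suc k) (gr_comp A J \<nu>) x in
      INF c\<in>{c. length c = Suc k \<and> part c \<noteq> \<zero>\<^bsub>gr_ring A \<nu>\<^esub>}. induced_hom A \<nu> \<omega> c (part c))"


section \<open>Iteration\<close>

text \<open>A ring with a multi-grading and a list of maps to the natural numbers and infinity.\<close>

record 'x valued_ring =
  vring :: "'x ring"
  ndeg :: nat
  hcomp :: "nat list \<Rightarrow> 'x set"
  vals :: "('x \<Rightarrow> enat) list"

definition well_valued :: "'x valued_ring \<Rightarrow> bool" where
  "well_valued S \<longleftrightarrow>
     multigraded (vring S) (ndeg S) (hcomp S) \<and>
     (\<forall>\<omega>\<in>set (vals S). valuation (vring S) \<omega> \<and> compatible (vring S) (ndeg S) (hcomp S) \<omega>)"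

definition gr_valued :: "'x valued_ring \<Rightarrow> ('x \<Rightarrow> enat) \<Rightarrow> (nat \<Rightarrow> 'x set) valued_ring" where
  "gr_valued S \<nu> =
     \<lparr> vring = gr_ring (vring S) \<nu>,
       ndeg = Suc (ndeg S),
       hcomp = gr_comp (vring S) (hcomp S) \<nu>,
       vals = map (induced_val (vring S) (ndeg S) (hcomp S) \<nu>) (vals S) \<rparr>"

text \<open>
  The type of \<^term>\<open>gr_valued S \<nu>\<close> differs from that of \<open>S\<close>, so \<^term>\<open>gr_valued\<close> cannot be iterated
  a variable number of times as it stands. After each step the structure is therefore replaced by
  an isomorphic copy on the original type, along an arbitrary map \<open>e\<close> that is injective on the
  carrier. Such a map exists for a valuation \<open>\<nu>\<close> (choose representatives of the cosets and
  add those of the non-zero components), and the choice does not matter up to isomorphism.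
\<close>

definition transport :: "('y \<Rightarrow> 'x) \<Rightarrow> 'y valued_ring \<Rightarrow> 'x valued_ring" where
  "transport e S = (let A = vring S; d = inv_into (carrier A) e in
     \<lparr> vring = \<lparr> carrier = e ` carrier A,
                 mult = (\<lambda>x y. e (d x \<otimes>\<^bsub>A\<^esub> d y)),
                 one = e \<one>\<^bsub>A\<^esub>,
                 zero = e \<zero>\<^bsub>A\<^esub>,
                 add = (\<lambda>x y. e (d x \<oplus>\<^bsub>A\<^esub> d y)) \<rparr>,
       ndeg = ndeg S,
       hcomp = (\<lambda>a. e ` hcomp S a),
       vals = map (\<lambda>\<omega> x. \<omega> (d x)) (vals S) \<rparr>)"

definition relabelling :: "'y valued_ring \<Rightarrow> 'y \<Rightarrow> 'x" where
  "relabelling S = (SOME e. inj_on e (carrier (vring S)))"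

definition gr_step :: "'x valued_ring \<Rightarrow> ('x \<Rightarrow> enat) \<Rightarrow> 'x valued_ring" where
  "gr_step S \<nu> = transport (relabelling (gr_valued S \<nu>)) (gr_valued S \<nu>)"

text \<open>
  \<open>gr_iter R \<nu>s k\<close> is the ring obtained from \<open>R\<close> by passing successively to the graded rings of
  (the maps induced by) the first \<open>k\<close> members of \<open>\<nu>s\<close>, with the maps induced by all members.
\<close>

primrec gr_iter :: "'x ring \<Rightarrow> ('x \<Rightarrow> enat) list \<Rightarrow> nat \<Rightarrow> 'x valued_ring" where
  "gr_iter R \<nu>s 0 = \<lparr> vring = R, ndeg = 0, hcomp = (\<lambda>a. carrier R), vals = \<nu>s \<rparr>"
| "gr_iter R \<nu>s (Suc k) = gr_step (gr_iter R \<nu>s k) (vals (gr_iter R \<nu>s k) ! k)"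

text \<open>
  No non-zero element of \<open>\<Lambda>\<close> is orthogonal to all the vectors; equivalently, their sum lies in the
  interior of the cone \<open>\<sigma>\<close>. For the ring of formal power series, the graded ring is the
  semigroup algebra only under this condition. For instance, let \<open>\<Lambda>\<close> be the semigroup of pairs of
  natural numbers and take the single vector \<open>(1, 0)\<close>: the component of degree 0 of the graded
  ring of \<open>\<complex>[[x, y]]\<close> is \<open>\<complex>[[y]]\<close>, that of the graded ring \<open>\<complex>[x, y]\<close> is \<open>\<complex>[y]\<close>.
  In general, if \<open>u\<close> is non-zero and orthogonal to all the vectors, then the component of degree
  0 is a local ring on the side of the power series, but not on the side of the
  semigroup algebra, where \<open>X\<^sup>u\<close> and \<open>1 + X\<^sup>u\<close> are not invertible.
\<close>

definition jointly_positive :: "(int ^ 'd) set \<Rightarrow> (int ^ 'd) list \<Rightarrow> bool" where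
  "jointly_positive \<Lambda> vs \<longleftrightarrow> (\<forall>u\<in>\<Lambda>. (\<forall>v\<in>set vs. pairing v u = 0) \<longrightarrow> u = 0)"

end

theory Submission
  imports Defs
begin

text \<open>
  Passing to the graded ring of a monomial valuation does not change the coefficient functions: a
  family of cosets in \<open>\<Oplus>\<^sub>b I(b)/I(b+1)\<close> is determined by the coefficients of degree exactly \<open>b\<close> of
  its \<open>b\<close>-th component, and these assemble to one function on \<open>\<Lambda>\<close>, which takes only finitely many
  values of \<open>\<langle>v,u\<rangle>\<close> on its support. So the ring after \<open>k\<close> steps is the ring of those elements
  of \<open>R\<close> whose support has finitely many degrees with respect to \<open>v\<^sub>1, \<dots>, v\<^sub>k\<close>, graded by these
  degrees, and the induced maps are still the monomial valuations. When no non-zero element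
  of \<open>\<Lambda>\<close> is orthogonal to all \<open>v\<^sub>j\<close>, each multidegree is attained finitely often, and what
  remains after \<open>r\<close> steps is the semigroup algebra.

  A linear functional \<open>w\<close> which is positive on the non-zero generators of \<open>\<Lambda>\<close> makes all the sums
  finite. That a monomial valuation is multiplicative follows by minimising \<open>\<langle>v,u\<rangle>\<close>, then \<open>w\<close>, over
  the supports of two series, and choosing among the remaining finitely many exponents two
  whose sum decomposes in only one way.
\<close>

section \<open>Coefficient functions, degrees and monomial valuations\<close>

abbreviation supp :: "('a \<Rightarrow> complex) \<Rightarrow> 'a set" where
  "supp f \<equiv> {u. f u \<noteq> 0}"

text \<open>The entries are natural numbers because the lists index graded components; on \<Lambda>,
  for vectors that are non-negative there, \<open>nat\<close> truncates nothing.\<close>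

definition mdeg :: "(int ^ 'd::finite) list \<Rightarrow> int ^ 'd \<Rightarrow> nat list" where
  "mdeg vs u = map (\<lambda>v. nat (pairing v u)) vs"

definition restrict_supp :: "('a \<Rightarrow> bool) \<Rightarrow> ('a \<Rightarrow> complex) \<Rightarrow> 'a \<Rightarrow> complex" where
  "restrict_supp P f u = (if P u then f u else 0)"

lemma pairing_add: "pairing v (a + b) = pairing v a + pairing v b"
  by (simp add: pairing_def algebra_simps sum.distrib)

lemma pairing_zero [simp]: "pairing v 0 = 0"
  by (simp add: pairing_def)

lemma length_mdeg [simp]: "length (mdeg vs u) = length vs"
  by (simp add: mdeg_def)

lemma le_monomial_val: "enat n \<le> monomial_val v f \<longleftrightarrow> (\<forall>u. f u \<noteq> 0 \<longrightarrow> n \<le> nat (pairing v u))"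
  by (simp add: monomial_val_def le_INF_iff)

lemma monomial_val_eqI:
  assumes "f a \<noteq> 0" "\<And>u. f u \<noteq> 0 \<Longrightarrow> nat (pairing v a) \<le> nat (pairing v u)"
  shows "monomial_val v f = enat (nat (pairing v a))"
  unfolding monomial_val_def using assms by (intro antisym INF_lower INF_greatest) auto

lemma monomial_val_0 [simp]: "monomial_val v (\<lambda>u. 0) = \<infinity>"
  by (simp add: monomial_val_def top_enat_def)

lemma monomial_val_antimono: "supp f \<subseteq> supp g \<Longrightarrow> monomial_val v g \<le> monomial_val v f"
  unfolding monomial_val_def by (rule INF_superset_mono) auto

lemma monomial_val_nonzero:
  assumes "f a \<noteq> 0" shows "monomial_val v f \<noteq> \<infinity>"
proof -
  have "monomial_val v f \<le> enat (nat (pairing v a))"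
    unfolding monomial_val_def by (rule INF_lower) (use assms in auto)
  then show ?thesis by (cases "monomial_val v f") auto
qed

text \<open>Maximising the Euclidean norm over a finite sumset produces a sum with a single
  decomposition: two decompositions \<open>a + b = a' + b'\<close> would make it the midpoint of
  \<open>a + b'\<close> and \<open>a' + b\<close>.\<close>

lemma unique_sum_finite:
  fixes A B :: "(int ^ 'd::finite) set"
  assumes "finite A" "finite B" "A \<noteq> {}" "B \<noteq> {}"
  obtains a b where "a \<in> A" "b \<in> B"
    "\<And>a' b'. \<lbrakk>a' \<in> A; b' \<in> B; a' + b' = a + b\<rbrakk> \<Longrightarrow> a' = a \<and> b' = b"
proof -
  define q :: "int ^ 'd \<Rightarrow> int" where "q x = (\<Sum>i\<in>UNIV. x $ i * x $ i)" for x
  have parallelogram: "q (x + y) + q (x - y) = 2 * q x + 2 * q y" for x y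
    by (simp add: q_def algebra_simps sum.distrib sum_subtractf)
  have q_zero: "x = 0" if "q x \<le> 0" for x
  proof -
    have "0 \<le> q x" unfolding q_def by (intro sum_nonneg) auto
    then have "q x = 0" using that by simp
    then have "\<forall>i. x $ i * x $ i = 0"
      unfolding q_def by (subst (asm) sum_nonneg_eq_0_iff) auto
    then show ?thesis by (simp add: vec_eq_iff)
  qed
  define S where "S = (\<lambda>(a, b). a + b) ` (A \<times> B)"
  have "finite S" "S \<noteq> {}" using assms by (auto simp: S_def)
  then obtain p where "is_arg_min (\<lambda>x. - q x) (\<lambda>x. x \<in> S) p"
    using ex_is_arg_min_if_finite by blast
  then have p: "p \<in> S" "\<And>s. s \<in> S \<Longrightarrow> q s \<le> q p"
    by (auto simp: is_arg_min_linorder)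
  then obtain a b where ab: "a \<in> A" "b \<in> B" "p = a + b" by (auto simp: S_def)
  have "a' = a \<and> b' = b" if "a' \<in> A" "b' \<in> B" "a' + b' = a + b" for a' b'
  proof -
    have "q (a + b') \<le> q p" "q (a' + b) \<le> q p"
      using that ab by (intro p(2); force simp: S_def)+
    moreover have "q ((a + b') + (a' + b)) = 4 * q p"
    proof -
      have "(a + b') + (a' + b) = p + p"
        using that(3) ab(3) by (simp add: algebra_simps)
      then show ?thesis using parallelogram[of p p] by (simp add: q_def)
    qed
    ultimately have "q ((a + b') - (a' + b)) \<le> 0"
      using parallelogram[of "a + b'" "a' + b"] by linarith
    then have "(a + b') - (a' + b) = 0" by (rule q_zero)
    then have "\<forall>i. a $ i + b' $ i = a' $ i + b $ i" "\<forall>i. a' $ i + b' $ i = a $ i + b $ i"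
      using that(3) by (auto simp: vec_eq_iff simp flip: vector_add_component)
    then have "\<forall>i. a' $ i = a $ i \<and> b' $ i = b $ i" by (smt (verit))
    then show ?thesis by (simp add: vec_eq_iff)
  qed
  with ab show thesis by (intro that) auto
qed


section \<open>Convolution on a pointed semigroup\<close>

text \<open>\<open>w\<close> is instantiated by a linear functional that is positive on the non-zero
  generators. Its finite sublevel sets bound the decompositions of an exponent and provide minima on
  subsets of \<Lambda>.\<close>

locale pointed_semigroup =
  fixes \<Lambda> :: "(int ^ 'd::finite) set" and w :: "int ^ 'd \<Rightarrow> real"
  assumes submonoid: "submonoid \<Lambda>"
    and w_add: "w (a + b) = w a + w b"
    and w_nonneg: "u \<in> \<Lambda> \<Longrightarrow> 0 \<le> w u"
    and w_finite: "finite {u \<in> \<Lambda>. w u \<le> n}"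
begin

lemma zero_in [simp]: "0 \<in> \<Lambda>" and add_in: "\<lbrakk>a \<in> \<Lambda>; b \<in> \<Lambda>\<rbrakk> \<Longrightarrow> a + b \<in> \<Lambda>"
  using submonoid by (auto simp: submonoid_def)

text \<open>An index set independent of the two factors, so that bilinear identities become
  identities between sums over one fixed finite set.\<close>

definition decomps :: "int ^ 'd \<Rightarrow> ((int ^ 'd) \<times> (int ^ 'd)) set" where
  "decomps u = {(a, b). a \<in> \<Lambda> \<and> b \<in> \<Lambda> \<and> a + b = u}"

text \<open>The first summand satisfies \<open>w a \<le> w u\<close>, because \<open>w\<close> is
  non-negative on the second, and it determines the second.\<close>

lemma finite_decomps [simp, intro]: "finite (decomps u)"
proof (rule finite_subset)
  show "decomps u \<subseteq> (\<lambda>a. (a, u - a)) ` {a \<in> \<Lambda>. w a \<le> w u}"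
    using w_nonneg by (force simp: decomps_def w_add)
qed (simp add: w_finite)

lemma convol_eq:
  assumes "supp f \<subseteq> \<Lambda>" "supp g \<subseteq> \<Lambda>"
  shows "convol f g u = (\<Sum>(a, b)\<in>decomps u. f a * g b)"
  unfolding convol_def
proof (rule sum.mono_neutral_left)
  show "{(a, b). f a \<noteq> 0 \<and> g b \<noteq> 0 \<and> a + b = u} \<subseteq> decomps u"
    using assms by (auto simp: decomps_def)
  show "\<forall>p\<in>decomps u - {(a, b). f a \<noteq> 0 \<and> g b \<noteq> 0 \<and> a + b = u}.
      (case p of (a, b) \<Rightarrow> f a * g b) = 0"
    by (auto simp: decomps_def)
qed (rule finite_decomps)

lemma supp_convol: "supp (convol f g) \<subseteq> {a + b |a b. f a \<noteq> 0 \<and> g b \<noteq> 0}"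
proof
  fix u assume "u \<in> supp (convol f g)"
  then have "{(a, b). f a \<noteq> 0 \<and> g b \<noteq> 0 \<and> a + b = u} \<noteq> {}"
    unfolding convol_def by (metis (mono_tags, lifting) mem_Collect_eq sum.empty)
  then show "u \<in> {a + b |a b. f a \<noteq> 0 \<and> g b \<noteq> 0}" by blast
qed

lemma supp_convol_subset:
  "\<lbrakk>supp f \<subseteq> \<Lambda>; supp g \<subseteq> \<Lambda>\<rbrakk> \<Longrightarrow> supp (convol f g) \<subseteq> \<Lambda>"
  using supp_convol[of f g] add_in by blast

lemma convol_assoc:
  assumes "supp f \<subseteq> \<Lambda>" "supp g \<subseteq> \<Lambda>" "supp h \<subseteq> \<Lambda>"
  shows "convol (convol f g) h = convol f (convol g h)"
proof
  fix u
  have "convol (convol f g) h u = (\<Sum>(a, b)\<in>decomps u. (\<Sum>(c, e)\<in>decomps a. f c * g e) * h b)"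
    by (simp add: convol_eq[OF supp_convol_subset[OF assms(1,2)] assms(3)] convol_eq[OF assms(1,2)])
  also have "\<dots> = (\<Sum>(p, q)\<in>Sigma (decomps u) (\<lambda>p. decomps (fst p)). f (fst q) * g (snd q) * h (snd p))"
    by (subst sum.Sigma[symmetric]) (auto simp: sum_distrib_right case_prod_beta)
  \<comment> \<open>Both sums run over the decompositions of \<open>u\<close> into three summands;
    the bijection only changes the bracketing.\<close>
  also have "\<dots> = (\<Sum>(p, q)\<in>Sigma (decomps u) (\<lambda>p. decomps (snd p)). f (fst p) * g (fst q) * h (snd q))"
    by (rule sum.reindex_bij_witness[where
          i = "\<lambda>(p, q). ((fst p + fst q, snd q), (fst p, fst q))" and
          j = "\<lambda>(p, q). ((fst q, snd q + snd p), (snd q, snd p))"])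
       (auto simp: decomps_def add_in add.assoc)
  also have "\<dots> = (\<Sum>(a, b)\<in>decomps u. f a * (\<Sum>(c, e)\<in>decomps b. g c * h e))"
    by (subst sum.Sigma[symmetric]) (auto simp: sum_distrib_left case_prod_beta mult.assoc)
  also have "\<dots> = convol f (convol g h) u"
    by (simp add: convol_eq[OF assms(1) supp_convol_subset[OF assms(2,3)]] convol_eq[OF assms(2,3)])
  finally show "convol (convol f g) h u = convol f (convol g h) u" .
qed

lemma convol_commute:
  assumes "supp f \<subseteq> \<Lambda>" "supp g \<subseteq> \<Lambda>"
  shows "convol f g = convol g f"
proof
  fix u
  show "convol f g u = convol g f u"
    unfolding convol_eq[OF assms] convol_eq[OF assms(2,1)]
    by (rule sum.reindex_bij_witness[where i = "\<lambda>(a, b). (b, a)" and j = "\<lambda>(a, b). (b, a)"])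
       (auto simp: decomps_def add.commute)
qed

lemma convol_add_left:
  assumes "supp f \<subseteq> \<Lambda>" "supp g \<subseteq> \<Lambda>" "supp h \<subseteq> \<Lambda>"
  shows "convol (\<lambda>u. f u + g u) h = (\<lambda>u. convol f h u + convol g h u)"
proof -
  have "supp (\<lambda>u. f u + g u) \<subseteq> \<Lambda>" using assms by (smt (verit) add_0 mem_Collect_eq subset_eq)
  then show ?thesis
    by (simp add: convol_eq assms fun_eq_iff sum.distrib[symmetric] case_prod_beta ring_distribs)
qed

lemma convol_one_left:
  "convol (\<lambda>u. if u = 0 then 1 else 0) f = f"
proof
  fix u
  have "{(a, b). (if a = 0 then 1 else 0 :: complex) \<noteq> 0 \<and> f b \<noteq> 0 \<and> a + b = u}
      = (if f u = 0 then {} else {(0, u)})"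
    by (auto split: if_splits)
  then show "convol (\<lambda>u. if u = 0 then 1 else 0) f u = f u"
    by (simp add: convol_def)
qed

lemma w_minimum:
  assumes "A \<subseteq> \<Lambda>" "A \<noteq> {}"
  obtains a where "a \<in> A" "\<And>a'. a' \<in> A \<Longrightarrow> w a \<le> w a'"
proof -
  obtain x where x: "x \<in> A" using assms by blast
  have "finite {a \<in> A. w a \<le> w x}"
    by (rule finite_subset[OF _ w_finite[of "w x"]]) (use assms in auto)
  then obtain a where "a \<in> {a \<in> A. w a \<le> w x}" "\<And>a'. a' \<in> {a \<in> A. w a \<le> w x} \<Longrightarrow> w a \<le> w a'"
    using x ex_is_arg_min_if_finite[of "{a \<in> A. w a \<le> w x}" w]
    by (auto simp: is_arg_min_linorder)
  then show thesis by (intro that[of a]) force+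
qed

text \<open>Minimising \<open>l\<close> and then \<open>w\<close> leaves finite sets of exponents,
  in which some sum decomposes uniquely. By additivity, any decomposition of that sum in
  \<open>A\<close> and \<open>B\<close> has minimal \<open>l\<close> and \<open>w\<close> in both
  summands, hence stays in those finite sets.\<close>

lemma unique_sum:
  assumes "A \<subseteq> \<Lambda>" "B \<subseteq> \<Lambda>" "A \<noteq> {}" "B \<noteq> {}"
    and l_add: "\<And>a b. \<lbrakk>a \<in> \<Lambda>; b \<in> \<Lambda>\<rbrakk> \<Longrightarrow> l (a + b) = l a + (l b :: nat)"
  obtains a b where "a \<in> A" "b \<in> B"
    "\<And>a'. a' \<in> A \<Longrightarrow> l a \<le> l a'" "\<And>b'. b' \<in> B \<Longrightarrow> l b \<le> l b'"
    "\<And>a' b'. \<lbrakk>a' \<in> A; b' \<in> B; a' + b' = a + b\<rbrakk> \<Longrightarrow> a' = a \<and> b' = b"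
proof -
  have lex_minimum: "\<exists>x\<in>X. \<forall>y\<in>X. l x \<le> l y \<and> (l y = l x \<longrightarrow> w x \<le> w y)"
    if X: "X \<subseteq> \<Lambda>" "X \<noteq> {}" for X
  proof -
    obtain x where x: "x \<in> X" "\<And>y. y \<in> X \<Longrightarrow> l x \<le> l y"
      using X(2) ex_has_least_nat[of "\<lambda>x. x \<in> X" _ l] by blast
    obtain z where "z \<in> {y \<in> X. l y = l x}" "\<And>y. y \<in> {y \<in> X. l y = l x} \<Longrightarrow> w z \<le> w y"
      by (rule w_minimum[of "{y \<in> X. l y = l x}"]) (use X x in auto)
    with x show ?thesis by (intro bexI[of _ z]) auto
  qed
  obtain x where x: "x \<in> A" "\<And>y. y \<in> A \<Longrightarrow> l x \<le> l y" "\<And>y. \<lbrakk>y \<in> A; l y = l x\<rbrakk> \<Longrightarrow> w x \<le> w y"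
    using lex_minimum[of A] assms by blast
  obtain z where z: "z \<in> B" "\<And>y. y \<in> B \<Longrightarrow> l z \<le> l y" "\<And>y. \<lbrakk>y \<in> B; l y = l z\<rbrakk> \<Longrightarrow> w z \<le> w y"
    using lex_minimum[of B] assms by blast
  define A' where "A' = {y \<in> A. l y = l x \<and> w y = w x}"
  define B' where "B' = {y \<in> B. l y = l z \<and> w y = w z}"
  have "finite A'"
    by (rule finite_subset[OF _ w_finite[of "w x"]]) (use assms in \<open>auto simp: A'_def\<close>)
  moreover have "finite B'"
    by (rule finite_subset[OF _ w_finite[of "w z"]]) (use assms in \<open>auto simp: B'_def\<close>)
  ultimately obtain a b where ab: "a \<in> A'" "b \<in> B'"
    and uniq: "\<And>a' b'. \<lbrakk>a' \<in> A'; b' \<in> B'; a' + b' = a + b\<rbrakk> \<Longrightarrow> a' = a \<and> b' = b"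
    by (rule unique_sum_finite[of A' B']) (use x z in \<open>auto simp: A'_def B'_def\<close>)
  have "a' = a \<and> b' = b" if that: "a' \<in> A" "b' \<in> B" "a' + b' = a + b" for a' b'
  proof -
    have l: "l a' + l b' = l x + l z"
      using ab that assms l_add[of a' b'] l_add[of a b] by (auto simp: A'_def B'_def subset_eq)
    then have "l a' = l x" "l b' = l z" using x(2)[OF that(1)] z(2)[OF that(2)] by auto
    moreover have "w a' + w b' = w x + w z"
      using ab that(3) w_add[of a' b'] w_add[of a b] by (auto simp: A'_def B'_def)
    ultimately have "a' \<in> A'" "b' \<in> B'"
      using x(3)[OF that(1)] z(3)[OF that(2)] that by (auto simp: A'_def B'_def)
    then show ?thesis using uniq that by blast
  qed
  with ab x z show thesis by (intro that[of a b]) (auto simp: A'_def B'_def)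
qed

section \<open>Multiplicativity of monomial valuations\<close>

definition nonneg :: "int ^ 'd \<Rightarrow> bool" where
  "nonneg v \<longleftrightarrow> (\<forall>u\<in>\<Lambda>. 0 \<le> pairing v u)"

lemma nat_pairing_add:
  "\<lbrakk>nonneg v; a \<in> \<Lambda>; b \<in> \<Lambda>\<rbrakk> \<Longrightarrow>
    nat (pairing v (a + b)) = nat (pairing v a) + nat (pairing v b)"
  by (simp add: nonneg_def pairing_add nat_add_distrib)

lemma mdeg_add:
  "\<lbrakk>\<forall>v\<in>set vs. nonneg v; a \<in> \<Lambda>; b \<in> \<Lambda>\<rbrakk> \<Longrightarrow> mdeg vs (a + b) = map2 (+) (mdeg vs a) (mdeg vs b)"
  by (induction vs) (auto simp: mdeg_def nat_pairing_add)

text \<open>The coefficient at the uniquely decomposed sum is the single product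
  \<open>f a * g b\<close>, which cannot cancel. As \<open>a\<close> and \<open>b\<close> have
  minimal degree in their supports, the value of the product is attained there.\<close>

lemma convol_valuation:
  assumes "supp f \<subseteq> \<Lambda>" "supp g \<subseteq> \<Lambda>" "f \<noteq> (\<lambda>u. 0)" "g \<noteq> (\<lambda>u. 0)" "nonneg v"
  shows "convol f g \<noteq> (\<lambda>u. 0)"
    and "monomial_val v (convol f g) = monomial_val v f + monomial_val v g"
proof -
  have ne: "supp f \<noteq> {}" "supp g \<noteq> {}" using assms(3,4) by auto
  have l_add: "nat (pairing v (a + b)) = nat (pairing v a) + nat (pairing v b)"
    if "a \<in> \<Lambda>" "b \<in> \<Lambda>" for a b using nat_pairing_add assms(5) that .
  obtain a b where ab: "a \<in> supp f" "b \<in> supp g"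
    and min: "\<And>a'. a' \<in> supp f \<Longrightarrow> nat (pairing v a) \<le> nat (pairing v a')"
      "\<And>b'. b' \<in> supp g \<Longrightarrow> nat (pairing v b) \<le> nat (pairing v b')"
    and uniq: "\<And>a' b'. \<lbrakk>a' \<in> supp f; b' \<in> supp g; a' + b' = a + b\<rbrakk> \<Longrightarrow> a' = a \<and> b' = b"
    by (rule unique_sum[OF assms(1,2) ne, of "\<lambda>u. nat (pairing v u)"])
       (auto intro: l_add)
  have "{(a', b'). f a' \<noteq> 0 \<and> g b' \<noteq> 0 \<and> a' + b' = a + b} = {(a, b)}"
    using ab uniq by auto
  then have "convol f g (a + b) = f a * g b" by (simp add: convol_def)
  then have nz: "convol f g (a + b) \<noteq> 0" using ab by simp
  then show "convol f g \<noteq> (\<lambda>u. 0)" by auto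
  have "monomial_val v (convol f g) = enat (nat (pairing v (a + b)))"
  proof (rule monomial_val_eqI[where a = "a + b"], rule nz)
    fix u assume "convol f g u \<noteq> 0"
    then obtain a' b' where u: "u = a' + b'" "f a' \<noteq> 0" "g b' \<noteq> 0"
      using supp_convol[of f g] by blast
    then have "a' \<in> \<Lambda>" "b' \<in> \<Lambda>" "a \<in> \<Lambda>" "b \<in> \<Lambda>" using assms ab by auto
    then show "nat (pairing v (a + b)) \<le> nat (pairing v u)"
      using min(1)[of a'] min(2)[of b'] u by (simp add: l_add)
  qed
  also have "\<dots> = enat (nat (pairing v a)) + enat (nat (pairing v b))"
    using ab assms l_add by (auto simp: subset_eq)
  also have "enat (nat (pairing v a)) = monomial_val v f"
    using ab min by (intro monomial_val_eqI[symmetric]) auto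
  also have "enat (nat (pairing v b)) = monomial_val v g"
    using ab min by (intro monomial_val_eqI[symmetric]) auto
  finally show "monomial_val v (convol f g) = monomial_val v f + monomial_val v g" .
qed

end

section \<open>Rings of functions with restricted supports\<close>

text \<open>The family \<F> of admissible supports treats both rings at once: all subsets of
  \<Lambda> give the power series, the finite ones the semigroup algebra.\<close>

locale support_family = pointed_semigroup \<Lambda> w for \<Lambda> :: "(int ^ 'd::finite) set" and w +
  fixes \<F> :: "(int ^ 'd) set set"
  assumes family_subset: "S \<in> \<F> \<Longrightarrow> S \<subseteq> \<Lambda>"
    and family_mono: "\<lbrakk>S \<in> \<F>; T \<subseteq> S\<rbrakk> \<Longrightarrow> T \<in> \<F>"
    and family_Un: "\<lbrakk>S \<in> \<F>; T \<in> \<F>\<rbrakk> \<Longrightarrow> S \<union> T \<in> \<F>"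
    and family_add: "\<lbrakk>S \<in> \<F>; T \<in> \<F>\<rbrakk> \<Longrightarrow> {a + b |a b. a \<in> S \<and> b \<in> T} \<in> \<F>"
    and family_zero: "{0} \<in> \<F>"
begin

text \<open>Finitely many degrees, since the elements of an iterated direct sum have finitely many
  non-zero components.\<close>

definition fns :: "(int ^ 'd) list \<Rightarrow> (int ^ 'd \<Rightarrow> complex) set" where
  "fns ds = {f. supp f \<in> \<F> \<and> finite (mdeg ds ` supp f)}"

lemma fns_supp: "f \<in> fns ds \<Longrightarrow> supp f \<subseteq> \<Lambda>"
  using family_subset by (simp add: fns_def)

lemma fns_in: "\<lbrakk>f \<in> fns ds; f u \<noteq> 0\<rbrakk> \<Longrightarrow> u \<in> \<Lambda>"
  using fns_supp by blast

lemma finite_mdeg: "f \<in> fns ds \<Longrightarrow> finite (mdeg ds ` supp f)"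
  by (simp add: fns_def)

lemma fns_mono: "\<lbrakk>f \<in> fns ds; supp g \<subseteq> supp f\<rbrakk> \<Longrightarrow> g \<in> fns ds"
  unfolding fns_def using family_mono[of "supp f" "supp g"] finite_subset[OF image_mono] by blast

lemma fns_Un:
  assumes "f \<in> fns ds" "g \<in> fns ds" "supp h \<subseteq> supp f \<union> supp g"
  shows "h \<in> fns ds"
proof -
  have "supp h \<in> \<F>"
    using family_mono[OF family_Un[of "supp f" "supp g"] assms(3)] assms by (simp add: fns_def)
  moreover have "finite (mdeg ds ` supp h)"
    using finite_subset[OF image_mono[OF assms(3), of "mdeg ds"]] assms by (simp add: fns_def image_Un)
  ultimately show ?thesis by (simp add: fns_def)
qed

lemma fns_0 [simp]: "(\<lambda>u. 0) \<in> fns ds"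
  using family_mono[OF family_zero, of "{}"] by (simp add: fns_def)

lemma fns_1 [simp]: "(\<lambda>u. if u = 0 then 1 else 0) \<in> fns ds"
  using family_zero by (simp add: fns_def)

lemma fns_restrict: "f \<in> fns ds \<Longrightarrow> restrict_supp P f \<in> fns ds"
  by (erule fns_mono) (auto simp: restrict_supp_def)

lemma fns_add: "\<lbrakk>f \<in> fns ds; g \<in> fns ds\<rbrakk> \<Longrightarrow> (\<lambda>u. f u + g u) \<in> fns ds"
  by (erule fns_Un, assumption) auto

lemma fns_diff: "\<lbrakk>f \<in> fns ds; g \<in> fns ds\<rbrakk> \<Longrightarrow> (\<lambda>u. f u - g u) \<in> fns ds"
  by (erule fns_Un, assumption) auto

lemma fns_uminus: "f \<in> fns ds \<Longrightarrow> (\<lambda>u. - f u) \<in> fns ds"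
  by (erule fns_mono) auto

text \<open>Serves to glue representatives of finitely many non-trivial cosets into one
  function.\<close>

lemma fns_UN:
  assumes "finite B" "\<And>b. b \<in> B \<Longrightarrow> f b \<in> fns ds" "supp g \<subseteq> (\<Union>b\<in>B. supp (f b))"
  shows "g \<in> fns ds"
  using assms
proof (induction B arbitrary: g rule: finite_induct)
  case empty
  then have "g = (\<lambda>u. 0)" by auto
  then show ?case by simp
next
  case (insert b B)
  \<comment> \<open>Outside the support of \<open>f b\<close>, the function \<open>g\<close> is
    covered by the remaining members of the family.\<close>
  have "restrict_supp (\<lambda>u. u \<notin> supp (f b)) g \<in> fns ds"
    using insert.prems by - (rule insert.IH, auto simp: restrict_supp_def)
  moreover have "f b \<in> fns ds" using insert.prems by simp
  moreover have "supp g \<subseteq> supp (restrict_supp (\<lambda>u. u \<notin> supp (f b)) g) \<union> supp (f b)"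
    by (simp add: restrict_supp_def subset_iff)
  ultimately show ?case by (rule fns_Un)
qed

text \<open>Degrees are additive on \<Lambda>, so finitely many degrees of the factors give finitely
  many for the product.\<close>

lemma fns_convol:
  assumes "f \<in> fns ds" "g \<in> fns ds" "\<forall>v\<in>set ds. nonneg v"
  shows "convol f g \<in> fns ds"
proof -
  let ?S = "{a + b |a b. a \<in> supp f \<and> b \<in> supp g}"
  have S: "supp (convol f g) \<subseteq> ?S" using supp_convol by simp
  have "supp (convol f g) \<in> \<F>"
    using assms by (intro family_mono[OF _ S] family_add) (auto simp: fns_def)
  moreover have "finite (mdeg ds ` supp (convol f g))"
  proof (rule finite_subset)
    show "mdeg ds ` supp (convol f g)
        \<subseteq> (\<lambda>(x, y). map2 (+) x y) ` ((mdeg ds ` supp f) \<times> (mdeg ds ` supp g))"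
    proof
      fix x assume "x \<in> mdeg ds ` supp (convol f g)"
      then obtain a b where ab: "f a \<noteq> 0" "g b \<noteq> 0" "x = mdeg ds (a + b)" using S by blast
      then have "x = map2 (+) (mdeg ds a) (mdeg ds b)"
        using assms fns_in by (auto intro!: mdeg_add)
      then show "x \<in> (\<lambda>(x, y). map2 (+) x y) ` ((mdeg ds ` supp f) \<times> (mdeg ds ` supp g))"
        using ab by (intro image_eqI[of _ _ "(mdeg ds a, mdeg ds b)"]) auto
    qed
  qed (use assms finite_mdeg in auto)
  ultimately show ?thesis by (simp add: fns_def)
qed

end

text \<open>A multi-graded ring \<open>A\<close> with components \<open>J\<close> is identified by \<open>\<phi>\<close> with the ring of those
  functions with support in \<open>\<F>\<close> which have only finitely many degrees under \<open>ds\<close>.\<close>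

locale represented = support_family \<Lambda> w \<F> for \<Lambda> :: "(int ^ 'd::finite) set" and w \<F> +
  fixes ds :: "(int ^ 'd) list"
    and A :: "'x ring" (structure)
    and J :: "nat list \<Rightarrow> 'x set"
    and \<phi> :: "'x \<Rightarrow> int ^ 'd \<Rightarrow> complex"
  assumes ds_nonneg: "\<forall>v\<in>set ds. nonneg v"
    and bij: "bij_betw \<phi> (carrier A) (fns ds)"
    and closed: "\<lbrakk>x \<in> carrier A; y \<in> carrier A\<rbrakk> \<Longrightarrow> x \<otimes> y \<in> carrier A"
      "\<lbrakk>x \<in> carrier A; y \<in> carrier A\<rbrakk> \<Longrightarrow> x \<oplus> y \<in> carrier A"
      "\<one> \<in> carrier A" "\<zero> \<in> carrier A"
    and hom: "\<lbrakk>x \<in> carrier A; y \<in> carrier A\<rbrakk> \<Longrightarrow> \<phi> (x \<otimes> y) = convol (\<phi> x) (\<phi> y)"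
      "\<lbrakk>x \<in> carrier A; y \<in> carrier A\<rbrakk> \<Longrightarrow> \<phi> (x \<oplus> y) = (\<lambda>u. \<phi> x u + \<phi> y u)"
      "\<phi> \<one> = (\<lambda>u. if u = 0 then 1 else 0)" "\<phi> \<zero> = (\<lambda>u. 0)"
    and comp: "length a = length ds \<Longrightarrow>
      J a = {x \<in> carrier A. \<forall>u. \<phi> x u \<noteq> 0 \<longrightarrow> mdeg ds u = a}"
begin

lemma repr_in: "x \<in> carrier A \<Longrightarrow> \<phi> x \<in> fns ds"
  using bij by (auto simp: bij_betw_def)

lemma repr_supp: "x \<in> carrier A \<Longrightarrow> supp (\<phi> x) \<subseteq> \<Lambda>"
  using repr_in fns_supp by blast

lemma repr_eq: "\<lbrakk>x \<in> carrier A; y \<in> carrier A\<rbrakk> \<Longrightarrow> x = y \<longleftrightarrow> \<phi> x = \<phi> y"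
  using bij by (auto simp: bij_betw_def inj_on_def)

definition mk :: "(int ^ 'd \<Rightarrow> complex) \<Rightarrow> 'x" where
  "mk = inv_into (carrier A) \<phi>"

lemma mk_in [simp]: "f \<in> fns ds \<Longrightarrow> mk f \<in> carrier A"
  and repr_mk [simp]: "f \<in> fns ds \<Longrightarrow> \<phi> (mk f) = f"
  using bij by (auto simp: bij_betw_def mk_def inv_into_into f_inv_into_f)

lemma zero_iff: "x \<in> carrier A \<Longrightarrow> x = \<zero> \<longleftrightarrow> \<phi> x = (\<lambda>u. 0)"
  using repr_eq[of x \<zero>] closed hom by simp

text \<open>The axioms are read off from convolution through the injective \<phi>; negatives come
  from the surjectivity of \<phi> onto \<open>fns ds\<close>.\<close>

lemma repr_domain: "domain A"
proof -
  have "abelian_group A"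
  proof (rule abelian_groupI)
    fix x assume x: "x \<in> carrier A"
    show "\<exists>y\<in>carrier A. y \<oplus> x = \<zero>"
      using x fns_uminus[OF repr_in[OF x]]
      by (intro bexI[of _ "mk (\<lambda>u. - \<phi> x u)"]) (auto simp: repr_eq closed hom)
  qed (auto simp: closed hom repr_eq add.assoc add.commute)
  moreover have "comm_monoid A"
    by (rule comm_monoidI)
       (simp_all add: closed hom repr_eq convol_assoc convol_one_left repr_supp
         convol_commute[OF repr_supp repr_supp])
  ultimately have "cring A"
    by (rule cringI) (simp add: closed hom repr_eq convol_add_left repr_supp)
  moreover have "domain_axioms A"
  proof
    show "\<one> \<noteq> \<zero>" using closed by (auto simp: repr_eq hom fun_eq_iff)
  next
    fix x y assume xy: "x \<otimes> y = \<zero>" "x \<in> carrier A" "y \<in> carrier A"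
    show "x = \<zero> \<or> y = \<zero>"
    proof (rule ccontr)
      assume "\<not> ?thesis"
      \<comment> \<open>That the product does not vanish depends on no vector; \<open>v = 0\<close>
        satisfies \<open>nonneg\<close> trivially.\<close>
      then have "convol (\<phi> x) (\<phi> y) \<noteq> (\<lambda>u. 0)"
        using xy by (intro convol_valuation(1)[where v = 0])
          (auto simp: zero_iff repr_supp nonneg_def pairing_def)
      then show False using xy hom(1)[of x y] hom(4) by simp
    qed
  qed
  ultimately show ?thesis by (rule domain.intro)
qed

sublocale domain A by (rule repr_domain)

lemma repr_minus:
  assumes "x \<in> carrier A" shows "\<phi> (\<ominus> x) = (\<lambda>u. - \<phi> x u)"
proof -
  have "\<phi> (\<ominus> x \<oplus> x) = (\<lambda>u. 0)" using assms by (simp add: l_neg hom)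
  then show ?thesis using assms by (simp add: hom fun_eq_iff eq_neg_iff_add_eq_0)
qed

section \<open>Homogeneous parts and the multi-grading\<close>

lemma repr_finsum:
  assumes "finite X" "\<And>i. i \<in> X \<Longrightarrow> f i \<in> carrier A"
  shows "\<phi> (finsum A f X) = (\<lambda>u. \<Sum>i\<in>X. \<phi> (f i) u)"
  using assms
  by (induction X rule: finite_induct) (simp_all add: hom finsum_insert Pi_def)

text \<open>Zero at lists of the wrong length is the convention of \<open>is_decomp\<close>.\<close>

definition part :: "'x \<Rightarrow> nat list \<Rightarrow> 'x" where
  "part x a = (if length a = length ds then mk (restrict_supp (\<lambda>u. mdeg ds u = a) (\<phi> x)) else \<zero>)"

lemma part_in: "x \<in> carrier A \<Longrightarrow> part x a \<in> carrier A"
  by (simp add: part_def fns_restrict repr_in)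

lemma repr_part: "x \<in> carrier A \<Longrightarrow> \<phi> (part x a) = restrict_supp (\<lambda>u. mdeg ds u = a) (\<phi> x)"
  by (cases "length a = length ds") (auto simp: part_def fns_restrict repr_in hom restrict_supp_def fun_eq_iff)

lemma part_nonzero: "x \<in> carrier A \<Longrightarrow> {a. part x a \<noteq> \<zero>} = mdeg ds ` supp (\<phi> x)"
  by (auto simp: zero_iff part_in repr_part restrict_supp_def fun_eq_iff)

lemma is_decomp_part:
  assumes x: "x \<in> carrier A"
  shows "is_decomp A (length ds) J x (part x)"
proof -
  have fin: "finite {a. part x a \<noteq> \<zero>}"
    by (simp add: part_nonzero x finite_mdeg[OF repr_in])
  have "\<phi> (finsum A (part x) {a. part x a \<noteq> \<zero>}) = \<phi> x"
  proof
    fix u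
    have "\<phi> (finsum A (part x) {a. part x a \<noteq> \<zero>}) u
        = (\<Sum>a\<in>{a. part x a \<noteq> \<zero>}. if a = mdeg ds u then \<phi> x u else 0)"
      using fin by (auto simp: repr_finsum part_in x repr_part restrict_supp_def intro: sum.cong)
    also have "\<dots> = \<phi> x u"
      using fin part_nonzero[OF x] by (auto simp: sum.delta)
    finally show "\<phi> (finsum A (part x) {a. part x a \<noteq> \<zero>}) u = \<phi> x u" .
  qed
  then have "x = finsum A (part x) {a. part x a \<noteq> \<zero>}"
    using x part_in by (subst repr_eq) auto
  moreover have "part x a \<in> J a" if "length a = length ds" for a
    using that x by (simp add: comp part_in repr_part restrict_supp_def)
  ultimately show ?thesis
    using fin by (simp add: is_decomp_def part_def)
qed

text \<open>At an exponent \<open>u\<close> only the component of index \<open>mdeg ds u\<close> can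
  contribute to the sum, which forces each component to be the restriction of
  \<open>\<phi> x\<close> to one degree.\<close>

lemma is_decomp_unique:
  assumes "x \<in> carrier A" "is_decomp A (length ds) J x f"
  shows "f = part x"
proof
  fix a
  have f_in: "f a \<in> carrier A" for a
    using assms(2) by (cases "length a = length ds") (auto simp: is_decomp_def comp)
  have fin: "finite {a. f a \<noteq> \<zero>}" and sum: "x = finsum A f {a. f a \<noteq> \<zero>}"
    using assms(2) by (simp_all add: is_decomp_def)
  have f_deg: "\<phi> (f a) u = 0" if "mdeg ds u \<noteq> a" for a u
    using assms(2) that by (cases "length a = length ds") (auto simp: is_decomp_def comp hom)
  have "\<phi> (f a) = \<phi> (part x a)"
  proof
    fix u
    have "\<phi> x u = (\<Sum>a\<in>{a. f a \<noteq> \<zero>}. \<phi> (f a) u)"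
      by (subst sum) (simp add: repr_finsum fin f_in)
    also have "\<dots> = (\<Sum>a\<in>{a. f a \<noteq> \<zero>}. if a = mdeg ds u then \<phi> (f (mdeg ds u)) u else 0)"
      using f_deg by (intro sum.cong) auto
    also have "\<dots> = \<phi> (f (mdeg ds u)) u"
      using fin by (auto simp: sum.delta hom)
    finally show "\<phi> (f a) u = \<phi> (part x a) u"
      using f_deg by (auto simp: repr_part assms restrict_supp_def)
  qed
  then show "f a = part x a" by (simp add: repr_eq f_in part_in assms)
qed

lemma hom_part_eq: "x \<in> carrier A \<Longrightarrow> hom_part A (length ds) J x = part x"
  unfolding hom_part_def using is_decomp_part is_decomp_unique by blast

lemma multigraded: "multigraded A (length ds) J"
  unfolding multigraded_def
proof (intro conjI allI impI ballI)
  show "ring A" by (rule ring_axioms)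
next
  fix a :: "nat list" assume a: "length a = length ds"
  show "additive_subgroup (J a) A"
  proof (intro additive_subgroup.intro add.subgroupI)
    show "J a \<noteq> {}" using closed(4) by (auto simp: comp a hom)
  next
    fix x assume "x \<in> J a"
    then show "\<ominus> x \<in> J a" by (simp add: comp a repr_minus)
  next
    fix x y assume "x \<in> J a" "y \<in> J a"
    then show "x \<oplus> y \<in> J a" by (simp add: comp a hom) (metis add_0)
  qed (auto simp: comp a)
next
  fix a b :: "nat list" and x y
  assume ab: "length a = length ds" "length b = length ds" and xy: "x \<in> J a" "y \<in> J b"
  have "mdeg ds u = map2 (+) a b" if u: "convol (\<phi> x) (\<phi> y) u \<noteq> 0" for u
  proof -
    obtain p q where pq: "u = p + q" "\<phi> x p \<noteq> 0" "\<phi> y q \<noteq> 0"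
      using u supp_convol[of "\<phi> x" "\<phi> y"] by blast
    then have "p \<in> \<Lambda>" "q \<in> \<Lambda>" using xy repr_supp by (auto simp: comp ab)
    then have "mdeg ds u = map2 (+) (mdeg ds p) (mdeg ds q)"
      using pq ds_nonneg by (simp add: mdeg_add)
    then show ?thesis using pq xy by (simp add: comp ab)
  qed
  then show "x \<otimes> y \<in> J (map2 (+) a b)"
    using xy by (simp add: comp ab closed hom)
next
  fix x assume "x \<in> carrier A"
  then show "\<exists>!f. is_decomp A (length ds) J x f"
    using is_decomp_part is_decomp_unique by blast
qed

section \<open>Monomial valuations on a represented ring\<close>

lemma valuation_monomial:
  assumes "nonneg v" and \<nu>: "\<And>x. x \<in> carrier A \<Longrightarrow> \<nu> x = monomial_val v (\<phi> x)"
  shows "valuation A \<nu>"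
  unfolding valuation_def
proof (intro conjI ballI)
  show "domain A" by (rule repr_domain)
next
  fix x assume "x \<in> carrier A"
  then show "\<nu> x = \<infinity> \<longleftrightarrow> x = \<zero>"
    using monomial_val_nonzero[of "\<phi> x" _ v] by (auto simp: \<nu> zero_iff simp del: not_infinity_eq)
next
  fix x y assume xy: "x \<in> carrier A" "y \<in> carrier A"
  show "\<nu> (x \<otimes> y) = \<nu> x + \<nu> y"
  proof (cases "x = \<zero> \<or> y = \<zero>")
    case True
    then show ?thesis using xy by (auto simp: \<nu> hom(4))
  next
    case False
    then show ?thesis
      using xy assms(1) convol_valuation(2)[of "\<phi> x" "\<phi> y" v]
      by (simp add: \<nu> zero_iff repr_supp hom)
  qed
  show "min (\<nu> x) (\<nu> y) \<le> \<nu> (x \<oplus> y)"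
  proof -
    have "supp (\<phi> (x \<oplus> y)) \<subseteq> supp (\<phi> x) \<union> supp (\<phi> y)" by (auto simp: hom xy)
    then have "monomial_val v (\<phi> (x \<oplus> y)) \<ge> Inf ((\<lambda>u. enat (nat (pairing v u))) ` (supp (\<phi> x) \<union> supp (\<phi> y)))"
      unfolding monomial_val_def by (intro INF_superset_mono) auto
    then show ?thesis
      by (simp add: \<nu> xy monomial_val_def image_Un Inf_union_distrib inf_min)
  qed
qed

text \<open>Passing to a homogeneous part shrinks the support and therefore cannot lower the
  value.\<close>

lemma compatible_monomial:
  assumes \<nu>: "\<And>x. x \<in> carrier A \<Longrightarrow> \<nu> x = monomial_val v (\<phi> x)"
  shows "compatible A (length ds) J \<nu>"
  unfolding compatible_def val_ideal_def
  by (auto simp: hom_part_eq part_in \<nu> repr_part le_monomial_val restrict_supp_def split: if_splits)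

end

section \<open>The graded ring of a monomial valuation\<close>

context support_family
begin

text \<open>Isolates the condition added by one more step. A list of degrees is determined by its
  initial segment and its last entry, so finiteness can be tested on these separately.\<close>

lemma fns_snoc:
  "f \<in> fns (ds @ [v]) \<longleftrightarrow> f \<in> fns ds \<and> finite ((\<lambda>u. nat (pairing v u)) ` supp f)"
proof -
  have deg: "mdeg (ds @ [v]) u = mdeg ds u @ [nat (pairing v u)]" for u
    by (simp add: mdeg_def)
  have "finite (mdeg (ds @ [v]) ` supp f) \<longleftrightarrow>
      finite (mdeg ds ` supp f) \<and> finite ((\<lambda>u. nat (pairing v u)) ` supp f)" (is "?l \<longleftrightarrow> ?r")
  proof
    assume ?l
    then have "finite (butlast ` mdeg (ds @ [v]) ` supp f)" "finite (last ` mdeg (ds @ [v]) ` supp f)"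
      by blast+
    then show ?r by (simp add: image_image deg)
  next
    assume r: ?r
    show ?l
      by (rule finite_subset[of _ "(\<lambda>(x, y). x @ [y]) `
            ((mdeg ds ` supp f) \<times> ((\<lambda>u. nat (pairing v u)) ` supp f))"])
         (use r in \<open>auto simp: deg image_iff\<close>)
  qed
  then show ?thesis by (auto simp: fns_def)
qed

end

context represented
begin

text \<open>\<open>grade v g b\<close> is the coset in \<open>I(b)/I(b+1)\<close> of the part of \<open>g\<close> of \<open>v\<close>-degree \<open>b\<close>.\<close>

definition grade :: "int ^ 'd \<Rightarrow> (int ^ 'd \<Rightarrow> complex) \<Rightarrow> nat \<Rightarrow> 'x set" where
  "grade v g b = {y \<in> carrier A. \<forall>u. nat (pairing v u) \<le> b \<longrightarrow>
     \<phi> y u = (if nat (pairing v u) = b then g u else 0)}"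

lemma gradeD:
  assumes "y \<in> grade v g b"
  shows "y \<in> carrier A" "nat (pairing v u) = b \<Longrightarrow> \<phi> y u = g u"
    "nat (pairing v u) < b \<Longrightarrow> \<phi> y u = 0"
  using assms by (auto simp: grade_def)

lemma mk_in_grade:
  "g \<in> fns ds \<Longrightarrow> mk (restrict_supp (\<lambda>u. nat (pairing v u) = b) g) \<in> grade v g b"
  by (simp add: grade_def fns_restrict restrict_supp_def)

lemma grade_cong:
  "(\<And>u. nat (pairing v u) = b \<Longrightarrow> f u = g u) \<Longrightarrow> grade v f b = grade v g b"
  by (auto simp: grade_def)

text \<open>Each coefficient is recovered from any member of the coset in the degree of its
  exponent; \<open>f \<in> fns ds\<close> guarantees that such a member exists.\<close>

lemma grade_inj:
  assumes "f \<in> fns ds" "grade v f = grade v g" shows "f = g"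
proof
  fix u
  let ?b = "nat (pairing v u)"
  have "mk (restrict_supp (\<lambda>u. nat (pairing v u) = ?b) f) \<in> grade v f ?b"
    by (rule mk_in_grade[OF assms(1)])
  then show "f u = g u" using gradeD(2)[of _ v f ?b u] gradeD(2)[of _ v g ?b u] assms(2) by metis
qed

context
  fixes v :: "int ^ 'd" and \<nu> :: "'x \<Rightarrow> enat"
  assumes v: "nonneg v" and \<nu>: "\<And>x. x \<in> carrier A \<Longrightarrow> \<nu> x = monomial_val v (\<phi> x)"
begin

lemma val_ideal_iff:
  "x \<in> val_ideal A \<nu> b \<longleftrightarrow> x \<in> carrier A \<and> (\<forall>u. \<phi> x u \<noteq> 0 \<longrightarrow> b \<le> nat (pairing v u))"
  by (auto simp: val_ideal_def \<nu> le_monomial_val)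

text \<open>Adding an element of \<open>I(b+1)\<close> changes only coefficients of degree above
  \<open>b\<close>, and two elements that agree up to degree \<open>b\<close> differ by such an
  element.\<close>

lemma coset_eq:
  assumes h: "h \<in> carrier A"
  shows "val_ideal A \<nu> (Suc b) +> h = {y \<in> carrier A. \<forall>u. nat (pairing v u) \<le> b \<longrightarrow> \<phi> y u = \<phi> h u}"
    (is "_ = ?S")
proof
  show "val_ideal A \<nu> (Suc b) +> h \<subseteq> ?S"
    using h by (fastforce simp: a_r_coset_def' val_ideal_iff closed hom Suc_le_eq)
  show "?S \<subseteq> val_ideal A \<nu> (Suc b) +> h"
  proof
    fix y assume y: "y \<in> ?S"
    let ?k = "mk (\<lambda>u. \<phi> y u - \<phi> h u)"
    have k: "(\<lambda>u. \<phi> y u - \<phi> h u) \<in> fns ds" using y h by (auto intro: fns_diff repr_in)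
    then have "?k \<in> val_ideal A \<nu> (Suc b)"
      using y by (auto simp: val_ideal_iff Suc_le_eq not_le[symmetric])
    moreover have "y = ?k \<oplus> h" using y h k by (subst repr_eq) (auto simp: closed hom)
    ultimately show "y \<in> val_ideal A \<nu> (Suc b) +> h" by (auto simp: a_r_coset_def')
  qed
qed

text \<open>The coefficients of \<open>h\<close> below degree \<open>b\<close> vanish, so the coset
  retains exactly those of degree \<open>b\<close>.\<close>

lemma coset_eq_grade:
  assumes "h \<in> val_ideal A \<nu> b"
  shows "val_ideal A \<nu> (Suc b) +> h = grade v (\<phi> h) b"
proof -
  have "\<phi> h u = (if nat (pairing v u) = b then \<phi> h u else 0)" if "nat (pairing v u) \<le> b" for u
    using assms that by (auto simp: val_ideal_iff)
  then show ?thesis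
    using assms by (subst coset_eq) (auto simp: val_ideal_iff grade_def)
qed

lemma val_ideal_eq_grade: "val_ideal A \<nu> (Suc b) = grade v (\<lambda>u. 0) b"
  by (auto simp: val_ideal_iff grade_def not_le[symmetric] Suc_le_eq)

lemma grade_eq_val_ideal_iff:
  assumes "g \<in> fns ds"
  shows "grade v g b = val_ideal A \<nu> (Suc b) \<longleftrightarrow> (\<forall>u. nat (pairing v u) = b \<longrightarrow> g u = 0)"
proof
  assume "grade v g b = val_ideal A \<nu> (Suc b)"
  then have "mk (restrict_supp (\<lambda>u. nat (pairing v u) = b) g) \<in> grade v (\<lambda>u. 0) b"
    using mk_in_grade[OF assms, of v b] val_ideal_eq_grade by simp
  then show "\<forall>u. nat (pairing v u) = b \<longrightarrow> g u = 0"
    using gradeD(2) mk_in_grade[OF assms, of v b] by metis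
next
  assume "\<forall>u. nat (pairing v u) = b \<longrightarrow> g u = 0"
  then show "grade v g b = val_ideal A \<nu> (Suc b)"
    unfolding val_ideal_eq_grade by (intro grade_cong) auto
qed

text \<open>Finitely many non-trivial cosets amount to finitely many \<open>v\<close>-degrees in the
  assembled function; conversely, the parts of a function of fixed \<open>v\<close>-degree represent
  all its cosets.\<close>

lemma gr_carrier: "carrier (gr_ring A \<nu>) = grade v ` fns (ds @ [v])"
proof (intro subset_antisym subsetI)
  fix x assume "x \<in> carrier (gr_ring A \<nu>)"
  then have "\<forall>b. \<exists>h\<in>val_ideal A \<nu> b. x b = val_ideal A \<nu> (Suc b) +> h"
    and fin: "finite {b. x b \<noteq> val_ideal A \<nu> (Suc b)}"
    by (auto simp: gr_ring_def Let_def)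
  then obtain h where h: "\<And>b. h b \<in> val_ideal A \<nu> b" "\<And>b. x b = val_ideal A \<nu> (Suc b) +> h b"
    by metis
  have hc: "h b \<in> carrier A" for b using h(1) by (simp add: val_ideal_iff)
  \<comment> \<open>From each representative \<open>h b\<close> only the coefficients of degree
    exactly \<open>b\<close> are kept.\<close>
  define g where "g u = \<phi> (h (nat (pairing v u))) u" for u
  have x: "x = grade v g"
    using coset_eq_grade[OF h(1)] h(2) by (auto simp: fun_eq_iff g_def intro!: grade_cong)
  let ?B = "{b. x b \<noteq> val_ideal A \<nu> (Suc b)}"
  have B: "nat (pairing v u) \<in> ?B" if "g u \<noteq> 0" for u
  proof
    show "x (nat (pairing v u)) \<noteq> val_ideal A \<nu> (Suc (nat (pairing v u)))"
      using h[of "nat (pairing v u)"] coset_eq_grade[OF h(1)] that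
        grade_eq_val_ideal_iff[OF repr_in[OF hc], of "nat (pairing v u)"]
      by (auto simp: g_def)
  qed
  have "g \<in> fns ds"
  proof (rule fns_UN[OF fin, of "\<lambda>b. \<phi> (h b)"])
    show "supp g \<subseteq> (\<Union>b\<in>?B. supp (\<phi> (h b)))"
    proof
      fix u assume "u \<in> supp g"
      then show "u \<in> (\<Union>b\<in>?B. supp (\<phi> (h b)))"
        using B[of u] by (intro UN_I[of "nat (pairing v u)"]) (auto simp: g_def)
    qed
  qed (simp add: repr_in hc)
  moreover have "finite ((\<lambda>u. nat (pairing v u)) ` supp g)"
    by (rule finite_subset[OF _ fin]) (use B in auto)
  ultimately show "x \<in> grade v ` fns (ds @ [v])"
    using x by (auto simp: fns_snoc)
next
  fix x assume "x \<in> grade v ` fns (ds @ [v])"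
  then obtain g where g: "x = grade v g" "g \<in> fns ds" "finite ((\<lambda>u. nat (pairing v u)) ` supp g)"
    by (auto simp: fns_snoc)
  have "\<exists>h\<in>val_ideal A \<nu> b. x b = val_ideal A \<nu> (Suc b) +> h" for b
  proof -
    let ?h = "mk (restrict_supp (\<lambda>u. nat (pairing v u) = b) g)"
    have h: "?h \<in> val_ideal A \<nu> b"
      using g by (auto simp: val_ideal_iff fns_restrict restrict_supp_def split: if_splits)
    then have "val_ideal A \<nu> (Suc b) +> ?h = x b"
      using g by (subst coset_eq_grade) (auto simp: fns_restrict restrict_supp_def intro!: grade_cong)
    with h show ?thesis by blast
  qed
  moreover have "finite {b. x b \<noteq> val_ideal A \<nu> (Suc b)}"
    by (rule finite_subset[OF _ g(3)]) (use g in \<open>auto simp: grade_eq_val_ideal_iff\<close>)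
  ultimately show "x \<in> carrier (gr_ring A \<nu>)"
    by (simp add: gr_ring_def Let_def)
qed

section \<open>Ring operations on families of cosets\<close>

lemma gr_zero: "\<zero>\<^bsub>gr_ring A \<nu>\<^esub> = grade v (\<lambda>u. 0)"
  by (simp add: gr_ring_def Let_def val_ideal_eq_grade)

lemma gr_one: "\<one>\<^bsub>gr_ring A \<nu>\<^esub> = grade v (\<lambda>u. if u = 0 then 1 else 0)"
proof
  fix b
  have "\<one> \<in> val_ideal A \<nu> 0" by (simp add: val_ideal_iff)
  then show "\<one>\<^bsub>gr_ring A \<nu>\<^esub> b = grade v (\<lambda>u. if u = 0 then 1 else 0) b"
    using coset_eq_grade[of \<one> 0]
    by (auto simp: gr_ring_def Let_def hom val_ideal_eq_grade intro!: grade_cong)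
qed

lemma gr_add:
  assumes "f \<in> fns ds" "g \<in> fns ds"
  shows "grade v f \<oplus>\<^bsub>gr_ring A \<nu>\<^esub> grade v g = grade v (\<lambda>u. f u + g u)"
proof
  fix b
  have "set_add A (grade v f b) (grade v g b) = grade v (\<lambda>u. f u + g u) b"
  proof (intro subset_antisym subsetI)
    fix y assume "y \<in> set_add A (grade v f b) (grade v g b)"
    then show "y \<in> grade v (\<lambda>u. f u + g u) b"
      by (auto simp: set_add_def' grade_def closed hom)
  next
    fix y assume y: "y \<in> grade v (\<lambda>u. f u + g u) b"
    \<comment> \<open>\<open>y\<close> splits into the degree \<open>b\<close> part of
      \<open>f\<close> and a remainder, which absorbs all higher terms and lies in the coset of
      \<open>g\<close>.\<close>
    let ?h = "mk (restrict_supp (\<lambda>u. nat (pairing v u) = b) f)"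
    let ?k = "mk (\<lambda>u. \<phi> y u - \<phi> ?h u)"
    have h: "?h \<in> grade v f b" by (rule mk_in_grade[OF assms(1)])
    have k: "(\<lambda>u. \<phi> y u - \<phi> ?h u) \<in> fns ds"
      using gradeD(1)[OF y] gradeD(1)[OF h] by (intro fns_diff repr_in)
    have "?k \<in> grade v g b"
      using y h k by (auto simp: grade_def)
    moreover have "y = ?h \<oplus> ?k"
      using gradeD(1)[OF y] gradeD(1)[OF h] k by (subst repr_eq) (auto simp: closed hom)
    ultimately show "y \<in> set_add A (grade v f b) (grade v g b)"
      using h by (auto simp: set_add_def')
  qed
  then show "(grade v f \<oplus>\<^bsub>gr_ring A \<nu>\<^esub> grade v g) b = grade v (\<lambda>u. f u + g u) b"
    by (simp add: gr_ring_def Let_def)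
qed

text \<open>For \<open>u = p + q\<close> of degree at most \<open>b\<close>, a term with index above
  the degree of \<open>p\<close> vanishes because of \<open>h i\<close>, one with smaller index
  because of \<open>k (b - i)\<close>. The term whose index is the degree of \<open>p\<close>
  survives only if \<open>u\<close> has degree exactly \<open>b\<close>.\<close>

lemma convol_graded:
  assumes fg: "f \<in> fns ds" "g \<in> fns ds"
    and h: "\<And>i. h i \<in> grade v f i" and k: "\<And>i. k i \<in> grade v g i"
    and u: "nat (pairing v u) \<le> b"
  shows "(\<Sum>i\<le>b. convol (\<phi> (h i)) (\<phi> (k (b - i))) u)
    = (if nat (pairing v u) = b then convol f g u else 0)"
proof -
  let ?d = "\<lambda>u. nat (pairing v u)"
  have inner: "(\<Sum>i\<le>b. \<phi> (h i) p * \<phi> (k (b - i)) q) = (if ?d u = b then f p * g q else 0)"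
    if pq: "(p, q) \<in> decomps u" for p q
  proof -
    have d: "?d u = ?d p + ?d q" using pq v by (auto simp: decomps_def nat_pairing_add)
    have "\<phi> (h i) p * \<phi> (k (b - i)) q = (if i = ?d p then if ?d u = b then f p * g q else 0 else 0)"
      if "i \<le> b" for i
    proof (cases i "?d p" rule: linorder_cases)
      case less
      then have "?d q < b - i" using d u by linarith
      then show ?thesis using gradeD(3)[OF k, of q "b - i"] less by simp
    next
      case greater
      then show ?thesis using gradeD(3)[OF h, of p i] by simp
    next
      case equal
      show ?thesis
      proof (cases "?d u = b")
        case True
        then have "?d q = b - i" using d equal by linarith
        then show ?thesis
          using gradeD(2)[OF k, of q "b - i"] gradeD(2)[OF h, of p i] equal True by simp
      next
        case False
        then have "?d q < b - i" using d equal u by linarith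
        then show ?thesis using gradeD(3)[OF k, of q "b - i"] equal False by simp
      qed
    qed
    then have "(\<Sum>i\<le>b. \<phi> (h i) p * \<phi> (k (b - i)) q)
        = (\<Sum>i\<le>b. if i = ?d p then if ?d u = b then f p * g q else 0 else 0)"
      by (intro sum.cong) auto
    then show ?thesis using d u by simp
  qed
  have "(\<Sum>i\<le>b. convol (\<phi> (h i)) (\<phi> (k (b - i))) u)
      = (\<Sum>i\<le>b. \<Sum>(p, q)\<in>decomps u. \<phi> (h i) p * \<phi> (k (b - i)) q)"
    using gradeD(1)[OF h] gradeD(1)[OF k] by (simp add: convol_eq repr_supp)
  also have "\<dots> = (\<Sum>(p, q)\<in>decomps u. \<Sum>i\<le>b. \<phi> (h i) p * \<phi> (k (b - i)) q)"
    by (subst sum.swap) (simp add: case_prod_beta)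
  also have "\<dots> = (\<Sum>(p, q)\<in>decomps u. if ?d u = b then f p * g q else 0)"
    using inner by (intro sum.cong) auto
  also have "\<dots> = (if ?d u = b then convol f g u else 0)"
    by (simp add: convol_eq fns_supp[OF fg(1)] fns_supp[OF fg(2)])
  finally show ?thesis .
qed

text \<open>All choices of representatives yield the same coset, so the union in the definition of
  the product collapses to it.\<close>

lemma gr_mult:
  assumes "f \<in> fns ds" "g \<in> fns ds"
  shows "grade v f \<otimes>\<^bsub>gr_ring A \<nu>\<^esub> grade v g = grade v (convol f g)"
proof
  fix b
  have coset: "val_ideal A \<nu> (Suc b) +> (\<Oplus>i\<in>{..b}. h i \<otimes> k (b - i)) = grade v (convol f g) b"
    if hk: "\<And>i. h i \<in> grade v f i" "\<And>i. k i \<in> grade v g i" for h k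
  proof -
    note h = gradeD(1)[OF hk(1)] and k = gradeD(1)[OF hk(2)]
    have "(\<Oplus>i\<in>{..b}. h i \<otimes> k (b - i)) \<in> carrier A"
      using h k by (intro finsum_closed) auto
    moreover have "\<phi> (\<Oplus>i\<in>{..b}. h i \<otimes> k (b - i)) u = (if nat (pairing v u) = b then convol f g u else 0)"
      if "nat (pairing v u) \<le> b" for u
      using convol_graded[OF assms hk that] h k by (subst repr_finsum) (auto simp: hom)
    ultimately show ?thesis
      by (auto simp: coset_eq grade_def)
  qed
  \<comment> \<open>These choices show that the index sets of the unions are non-empty.\<close>
  have "(\<lambda>i. mk (restrict_supp (\<lambda>u. nat (pairing v u) = i) f)) \<in> {h. \<forall>i. h i \<in> grade v f i}"
    "(\<lambda>i. mk (restrict_supp (\<lambda>u. nat (pairing v u) = i) g)) \<in> {h. \<forall>i. h i \<in> grade v g i}"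
    using assms by (auto intro: mk_in_grade)
  then have "(\<Union>h\<in>{h. \<forall>i. h i \<in> grade v f i}. \<Union>k\<in>{k. \<forall>i. k i \<in> grade v g i}.
      val_ideal A \<nu> (Suc b) +> (\<Oplus>i\<in>{..b}. h i \<otimes> k (b - i))) = grade v (convol f g) b"
    using coset by auto
  then show "(grade v f \<otimes>\<^bsub>gr_ring A \<nu>\<^esub> grade v g) b = grade v (convol f g) b"
    by (simp add: gr_ring_def Let_def)
qed

lemma gr_comp_eq:
  assumes "length c = Suc (length ds)"
  shows "gr_comp A J \<nu> c = grade v ` {g \<in> fns (ds @ [v]). \<forall>u. g u \<noteq> 0 \<longrightarrow> mdeg (ds @ [v]) u = c}"
proof -
  obtain a b where c: "c = a @ [b]" "length a = length ds"
    using assms by (metis length_append_singleton length_butlast append_butlast_last_id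
        diff_Suc_1 list.size(3) nat.distinct(1))
  have deg: "mdeg (ds @ [v]) u = mdeg ds u @ [nat (pairing v u)]" for u
    by (simp add: mdeg_def)
  \<comment> \<open>A family whose only possibly non-trivial coset sits in degree \<open>b\<close>
    comes from the degree \<open>b\<close> part of the representative.\<close>
  have family: "(\<lambda>i. if i = b then val_ideal A \<nu> (Suc i) +> h else val_ideal A \<nu> (Suc i))
      = grade v (restrict_supp (\<lambda>u. nat (pairing v u) = b) (\<phi> h))"
    if "h \<in> val_ideal A \<nu> b" for h
    using coset_eq_grade[OF that]
    by (auto simp: fun_eq_iff val_ideal_eq_grade restrict_supp_def intro!: grade_cong)
  show ?thesis
  proof (intro subset_antisym subsetI)
    fix x assume "x \<in> gr_comp A J \<nu> c"
    then obtain h where h: "h \<in> val_ideal A \<nu> b" "h \<in> J a"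
      and x: "x = grade v (restrict_supp (\<lambda>u. nat (pairing v u) = b) (\<phi> h))"
      using family by (auto simp: gr_comp_def c)
    let ?g = "restrict_supp (\<lambda>u. nat (pairing v u) = b) (\<phi> h)"
    have "finite ((\<lambda>u. nat (pairing v u)) ` supp ?g)"
      by (rule finite_subset[of _ "{b}"]) (auto simp: restrict_supp_def)
    then have "?g \<in> fns (ds @ [v])"
      using h by (simp add: fns_snoc fns_restrict repr_in val_ideal_iff)
    moreover have "mdeg (ds @ [v]) u = c" if "?g u \<noteq> 0" for u
      using that h by (auto simp: deg c comp restrict_supp_def split: if_splits)
    ultimately show "x \<in> grade v ` {g \<in> fns (ds @ [v]). \<forall>u. g u \<noteq> 0 \<longrightarrow> mdeg (ds @ [v]) u = c}"
      using x by blast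
  next
    fix x assume "x \<in> grade v ` {g \<in> fns (ds @ [v]). \<forall>u. g u \<noteq> 0 \<longrightarrow> mdeg (ds @ [v]) u = c}"
    then obtain g where g: "g \<in> fns ds" "x = grade v g" "\<And>u. g u \<noteq> 0 \<Longrightarrow> mdeg (ds @ [v]) u = c"
      by (auto simp: fns_snoc)
    have "mk g \<in> val_ideal A \<nu> b" "mk g \<in> J a"
      using g by (auto simp: val_ideal_iff comp c deg)
    moreover have "restrict_supp (\<lambda>u. nat (pairing v u) = b) g = g"
      using g(3) by (auto simp: restrict_supp_def fun_eq_iff deg c)
    ultimately show "x \<in> gr_comp A J \<nu> c"
      unfolding gr_comp_def using family[of "mk g"] g
      by (intro CollectI exI[of _ "mk g"]) (auto simp: c)
  qed
qed

definition gr_repr :: "(nat \<Rightarrow> 'x set) \<Rightarrow> int ^ 'd \<Rightarrow> complex" where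
  "gr_repr = inv_into (fns (ds @ [v])) (grade v)"

lemma inj_grade: "inj_on (grade v) (fns (ds @ [v]))"
  using grade_inj by (auto simp: inj_on_def fns_snoc)

lemma gr_repr_grade [simp]: "g \<in> fns (ds @ [v]) \<Longrightarrow> gr_repr (grade v g) = g"
  unfolding gr_repr_def by (rule inv_into_f_f[OF inj_grade])

text \<open>The inductive step: the identification with coefficient functions persists, so that the
  next graded ring can be taken in the same locale.\<close>

lemma represented_gr:
  "represented \<Lambda> w \<F> (ds @ [v]) (gr_ring A \<nu>) (gr_comp A J \<nu>) gr_repr"
proof -
  have nn: "\<forall>v'\<in>set (ds @ [v]). nonneg v'" using ds_nonneg v by simp
  show ?thesis
  proof unfold_locales
    show "\<forall>v'\<in>set (ds @ [v]). nonneg v'" by (rule nn)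
    show "bij_betw gr_repr (carrier (gr_ring A \<nu>)) (fns (ds @ [v]))"
      unfolding gr_carrier gr_repr_def by (intro bij_betw_inv_into inj_on_imp_bij_betw inj_grade)
    show "\<one>\<^bsub>gr_ring A \<nu>\<^esub> \<in> carrier (gr_ring A \<nu>)" "\<zero>\<^bsub>gr_ring A \<nu>\<^esub> \<in> carrier (gr_ring A \<nu>)"
      by (auto simp: gr_carrier gr_one gr_zero)
    show "gr_repr \<one>\<^bsub>gr_ring A \<nu>\<^esub> = (\<lambda>u. if u = 0 then 1 else 0)" "gr_repr \<zero>\<^bsub>gr_ring A \<nu>\<^esub> = (\<lambda>u. 0)"
      by (simp_all add: gr_one gr_zero)
    fix c :: "nat list" assume "length c = length (ds @ [v])"
    then show "gr_comp A J \<nu> c =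
        {x \<in> carrier (gr_ring A \<nu>). \<forall>u. gr_repr x u \<noteq> 0 \<longrightarrow> mdeg (ds @ [v]) u = c}"
      by (auto simp: gr_comp_eq gr_carrier)
  next
    fix x y assume "x \<in> carrier (gr_ring A \<nu>)" "y \<in> carrier (gr_ring A \<nu>)"
    then obtain f g where fg: "f \<in> fns (ds @ [v])" "g \<in> fns (ds @ [v])" "x = grade v f" "y = grade v g"
      by (auto simp: gr_carrier)
    then have fg': "f \<in> fns ds" "g \<in> fns ds" by (simp_all add: fns_snoc)
    have cl: "convol f g \<in> fns (ds @ [v])" "(\<lambda>u. f u + g u) \<in> fns (ds @ [v])"
      using fg nn by (auto intro!: fns_add fns_convol simp del: set_append)
    show "x \<otimes>\<^bsub>gr_ring A \<nu>\<^esub> y \<in> carrier (gr_ring A \<nu>)"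
      "x \<oplus>\<^bsub>gr_ring A \<nu>\<^esub> y \<in> carrier (gr_ring A \<nu>)"
      "gr_repr (x \<otimes>\<^bsub>gr_ring A \<nu>\<^esub> y) = convol (gr_repr x) (gr_repr y)"
      "gr_repr (x \<oplus>\<^bsub>gr_ring A \<nu>\<^esub> y) = (\<lambda>u. gr_repr x u + gr_repr y u)"
      using fg fg' cl by (auto simp: gr_mult gr_add gr_carrier)
  qed
qed

text \<open>Among the representatives of a homogeneous class, the one without higher terms has the
  largest value: the support of every other one contains that of \<open>g\<close>.\<close>

lemma induced_hom_eq:
  assumes \<omega>: "\<And>x. x \<in> carrier A \<Longrightarrow> \<omega> x = monomial_val v' (\<phi> x)"
    and g: "g \<in> fns ds" "\<And>u. g u \<noteq> 0 \<Longrightarrow> nat (pairing v u) = last c"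
  shows "induced_hom A \<nu> \<omega> c (grade v g) = monomial_val v' g"
  unfolding induced_hom_def
proof (rule antisym)
  let ?X = "{\<omega> h |h. h \<in> carrier A \<and> val_ideal A \<nu> (Suc (last c)) +> h = grade v g (last c)}"
  have "mk g \<in> val_ideal A \<nu> (last c)" using g by (simp add: val_ideal_iff)
  then have "val_ideal A \<nu> (Suc (last c)) +> mk g = grade v g (last c)"
    using coset_eq_grade g by simp
  moreover have "\<omega> (mk g) = monomial_val v' g" using g \<omega> by simp
  ultimately have "monomial_val v' g \<in> ?X"
    using mk_in[OF g(1)] by (intro CollectI exI[of _ "mk g"]) simp
  then show "monomial_val v' g \<le> Sup ?X" by (rule Sup_upper)
  show "Sup ?X \<le> monomial_val v' g"
  proof (rule Sup_least)
    fix e assume "e \<in> ?X"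
    then obtain h where h: "e = \<omega> h" "h \<in> carrier A"
      "val_ideal A \<nu> (Suc (last c)) +> h = grade v g (last c)" by blast
    have "h \<in> val_ideal A \<nu> (Suc (last c)) +> h" using h(2) by (simp add: coset_eq)
    then have "h \<in> grade v g (last c)" using h(3) by simp
    then have "supp g \<subseteq> supp (\<phi> h)" using gradeD(2)[of h v g "last c"] g(2) by auto
    then show "e \<le> monomial_val v' g" using h \<omega> by (simp add: monomial_val_antimono)
  qed
qed

text \<open>Each exponent lies in exactly one homogeneous part, so the minimum of the values of the
  parts is the minimum over the whole support.\<close>

lemma induced_val_eq:
  assumes \<omega>: "\<And>x. x \<in> carrier A \<Longrightarrow> \<omega> x = monomial_val v' (\<phi> x)"
    and x: "x \<in> carrier (gr_ring A \<nu>)"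
  shows "induced_val A (length ds) J \<nu> \<omega> x = monomial_val v' (gr_repr x)"
proof -
  interpret G: represented \<Lambda> w \<F> "ds @ [v]" "gr_ring A \<nu>" "gr_comp A J \<nu>" gr_repr
    by (rule represented_gr)
  define g where "g = gr_repr x"
  have g: "g \<in> fns (ds @ [v])" using G.repr_in x by (simp add: g_def)
  let ?g = "\<lambda>c. restrict_supp (\<lambda>u. mdeg (ds @ [v]) u = c) g"
  have part: "hom_part (gr_ring A \<nu>) (Suc (length ds)) (gr_comp A J \<nu>) x c = grade v (?g c)" for c
  proof -
    have "G.part x c \<in> grade v ` fns (ds @ [v])" using G.part_in[OF x] by (simp add: gr_carrier)
    then have "G.part x c = grade v (gr_repr (G.part x c))" by auto
    then show ?thesis using G.hom_part_eq[OF x] by (simp add: G.repr_part x g_def)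
  qed
  have supp_g: "{c. length c = Suc (length ds) \<and>
      hom_part (gr_ring A \<nu>) (Suc (length ds)) (gr_comp A J \<nu>) x c \<noteq> \<zero>\<^bsub>gr_ring A \<nu>\<^esub>}
    = mdeg (ds @ [v]) ` supp g"
    using G.part_nonzero[OF x] G.hom_part_eq[OF x] by (auto simp: g_def)
  have hom: "induced_hom A \<nu> \<omega> c (grade v (?g c)) = monomial_val v' (?g c)" for c
  proof (rule induced_hom_eq[OF \<omega>])
    show "?g c \<in> fns ds" using g by (simp add: fns_snoc fns_restrict)
    fix u assume "?g c u \<noteq> 0"
    then show "nat (pairing v u) = last c"
      by (auto simp: restrict_supp_def mdeg_def split: if_splits)
  qed
  have "induced_val A (length ds) J \<nu> \<omega> x
      = (INF c\<in>mdeg (ds @ [v]) ` supp g. monomial_val v' (?g c))"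
    unfolding induced_val_def Let_def supp_g by (simp add: part hom)
  also have "\<dots> = monomial_val v' g"
  proof (rule antisym)
    show "(INF c\<in>mdeg (ds @ [v]) ` supp g. monomial_val v' (?g c)) \<le> monomial_val v' g"
      unfolding monomial_val_def[of v' g]
    proof (rule INF_greatest)
      fix u assume u: "u \<in> supp g"
      have "(INF c\<in>mdeg (ds @ [v]) ` supp g. monomial_val v' (?g c))
          \<le> monomial_val v' (?g (mdeg (ds @ [v]) u))"
        using u by (intro INF_lower) auto
      also have "\<dots> \<le> enat (nat (pairing v' u))"
        unfolding monomial_val_def using u by (intro INF_lower) (auto simp: restrict_supp_def)
      finally show "(INF c\<in>mdeg (ds @ [v]) ` supp g. monomial_val v' (?g c)) \<le> enat (nat (pairing v' u))" .
    qed
    show "monomial_val v' g \<le> (INF c\<in>mdeg (ds @ [v]) ` supp g. monomial_val v' (?g c))"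
      by (intro INF_greatest monomial_val_antimono) (auto simp: restrict_supp_def)
  qed
  finally show ?thesis by (simp add: g_def)
qed

end

end

section \<open>Iteration\<close>

context support_family
begin

text \<open>The invariant of the iteration: \<open>ds\<close> lists the vectors used so far and
  grows, \<open>vs\<close> lists the vectors of all the maps and stays fixed.\<close>

definition represents ::
    "(int ^ 'd) list \<Rightarrow> (int ^ 'd) list \<Rightarrow> 'x valued_ring \<Rightarrow> ('x \<Rightarrow> int ^ 'd \<Rightarrow> complex) \<Rightarrow> bool" where
  "represents ds vs S \<phi> \<longleftrightarrow>
     represented \<Lambda> w \<F> ds (vring S) (hcomp S) \<phi> \<and>
     ndeg S = length ds \<and> length (vals S) = length vs \<and>
     (\<forall>i<length vs. \<forall>x\<in>carrier (vring S). (vals S ! i) x = monomial_val (vs ! i) (\<phi> x))"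

lemma represents_well_valued:
  assumes "represents ds vs S \<phi>" "\<forall>v\<in>set vs. nonneg v"
  shows "well_valued S"
proof -
  interpret represented \<Lambda> w \<F> ds "vring S" "hcomp S" \<phi>
    using assms by (simp add: represents_def)
  have "valuation (vring S) \<omega> \<and> compatible (vring S) (length ds) (hcomp S) \<omega>"
    if "\<omega> \<in> set (vals S)" for \<omega>
  proof -
    obtain i where i: "i < length vs" "\<omega> = vals S ! i"
      using \<open>\<omega> \<in> set (vals S)\<close> assms(1) by (auto simp: in_set_conv_nth represents_def)
    then have "nonneg (vs ! i)" using assms(2) by simp
    moreover have "\<omega> x = monomial_val (vs ! i) (\<phi> x)" if "x \<in> carrier (vring S)" for x
      using assms(1) i that by (simp add: represents_def)
    ultimately show ?thesis using valuation_monomial compatible_monomial by blast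
  qed
  then show ?thesis
    using multigraded assms(1) by (simp add: well_valued_def represents_def)
qed

lemma represents_gr_valued:
  assumes S: "represents ds vs S \<phi>" and vs: "\<forall>v\<in>set vs. nonneg v" and i: "i < length vs"
  obtains \<psi> where "represents (ds @ [vs ! i]) vs (gr_valued S (vals S ! i)) \<psi>"
proof -
  interpret represented \<Lambda> w \<F> ds "vring S" "hcomp S" \<phi>
    using S by (simp add: represents_def)
  have v: "nonneg (vs ! i)" using vs i by simp
  have val: "(vals S ! j) x = monomial_val (vs ! j) (\<phi> x)"
    if "j < length vs" "x \<in> carrier (vring S)" for j x
    using S that by (simp add: represents_def)
  have "represents (ds @ [vs ! i]) vs (gr_valued S (vals S ! i)) (gr_repr (vs ! i))"
    unfolding represents_def gr_valued_def
    using represented_gr[OF v val[OF i]] induced_val_eq[OF v val[OF i] val] S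
    by (simp add: represents_def)
  then show thesis by (rule that)
qed

text \<open>On the carrier the inverse of \<open>e\<close> undoes \<open>e\<close>, so precomposing
  \<phi> with it carries all operations and maps back unchanged.\<close>

lemma represents_transport:
  assumes S: "represents ds vs S \<phi>" and e: "inj_on e (carrier (vring S))"
  shows "represents ds vs (transport e S) (\<lambda>x. \<phi> (inv_into (carrier (vring S)) e x))"
proof -
  interpret represented \<Lambda> w \<F> ds "vring S" "hcomp S" \<phi>
    using S by (simp add: represents_def)
  let ?d = "inv_into (carrier (vring S)) e"
  have d [simp]: "?d (e x) = x" if "x \<in> carrier (vring S)" for x
    using e that by simp
  have "represented \<Lambda> w \<F> ds (vring (transport e S)) (hcomp (transport e S)) (\<lambda>x. \<phi> (?d x))"
  proof unfold_locales
    show "\<forall>v\<in>set ds. nonneg v" by (rule ds_nonneg)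
    have "bij_betw ?d (e ` carrier (vring S)) (carrier (vring S))"
      by (intro bij_betw_inv_into inj_on_imp_bij_betw e)
    from bij_betw_trans[OF this bij]
    show "bij_betw (\<lambda>x. \<phi> (?d x)) (carrier (vring (transport e S))) (fns ds)"
      by (simp add: transport_def Let_def comp_def)
    fix a :: "nat list" assume "length a = length ds"
    then show "hcomp (transport e S) a = {x \<in> carrier (vring (transport e S)).
        \<forall>u. \<phi> (?d x) u \<noteq> 0 \<longrightarrow> mdeg ds u = a}"
      by (auto simp: transport_def Let_def comp)
  qed (auto simp: transport_def Let_def closed hom)
  then show ?thesis
    using S by (auto simp: represents_def transport_def Let_def)
qed

text \<open>The representation \<phi> is itself an injection of the carrier into coefficient
  functions, so the \<open>SOME\<close> in \<open>relabelling\<close> picks an injective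
  map.\<close>

lemma inj_on_relabelling:
  fixes S :: "'y valued_ring"
  assumes "represents ds vs S \<phi>"
  shows "inj_on (relabelling S :: 'y \<Rightarrow> int ^ 'd \<Rightarrow> complex) (carrier (vring S))"
proof -
  interpret represented \<Lambda> w \<F> ds "vring S" "hcomp S" \<phi>
    using assms by (simp add: represents_def)
  show ?thesis
    unfolding relabelling_def
    by (rule someI[of "\<lambda>e. inj_on e (carrier (vring S))"]) (rule bij_betw_imp_inj_on[OF bij])
qed

lemma represents_gr_step:
  fixes S :: "(int ^ 'd \<Rightarrow> complex) valued_ring"
  assumes "represents ds vs S \<phi>" "\<forall>v\<in>set vs. nonneg v" "i < length vs"
  obtains \<psi> where "represents (ds @ [vs ! i]) vs (gr_step S (vals S ! i)) \<psi>"
proof -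
  obtain \<psi> where \<psi>: "represents (ds @ [vs ! i]) vs (gr_valued S (vals S ! i)) \<psi>"
    by (rule represents_gr_valued[OF assms])
  from represents_transport[OF this inj_on_relabelling[OF this]] show thesis
    unfolding gr_step_def[symmetric] by (rule that)
qed

lemma represents_gr_iter:
  assumes "R = (semigroup_series \<Lambda>)\<lparr>carrier := {f. supp f \<in> \<F>}\<rparr>"
    and vs: "\<forall>v\<in>set vs. nonneg v" and "k \<le> length vs"
  shows "\<exists>\<phi>. represents (take k vs) vs (gr_iter R (map monomial_val vs) k) \<phi>"
  using \<open>k \<le> length vs\<close>
proof (induction k)
  case 0
  \<comment> \<open>\<open>mdeg []\<close> takes the single value \<open>[]\<close>, so before the
    first step degrees impose no condition.\<close>
  have fns: "fns [] = {f. supp f \<in> \<F>}"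
    by (auto simp: fns_def mdeg_def intro: finite_subset[of _ "{[]}"])
  have "represented \<Lambda> w \<F> [] R (\<lambda>a. carrier R) (\<lambda>f. f)"
  proof unfold_locales
    show "bij_betw (\<lambda>f. f) (carrier R) (fns [])"
      by (simp add: fns assms(1) bij_betw_def inj_on_def)
  next
    fix f g assume "f \<in> carrier R" "g \<in> carrier R"
    then have "f \<in> fns []" "g \<in> fns []" by (simp_all add: fns assms(1))
    then have "convol f g \<in> fns []" "(\<lambda>u. f u + g u) \<in> fns []"
      by (auto intro: fns_add fns_convol)
    then show "f \<otimes>\<^bsub>R\<^esub> g \<in> carrier R" "f \<oplus>\<^bsub>R\<^esub> g \<in> carrier R"
      by (simp_all add: fns assms(1) semigroup_series_def)
  qed (use fns_0[of "[]"] fns_1[of "[]"] in \<open>auto simp: assms(1) semigroup_series_def mdeg_def fns\<close>)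
  then show ?case by (intro exI[of _ "\<lambda>f. f"]) (simp add: represents_def)
next
  case (Suc k)
  then obtain \<phi> where "represents (take k vs) vs (gr_iter R (map monomial_val vs) k) \<phi>" by auto
  from represents_gr_step[OF this vs, of k] Suc.prems
  show ?case by (auto simp: take_Suc_conv_app_nth)
qed

end


section \<open>Finiteness for finitely generated semigroups\<close>

lemma submonoid_hull: "submonoid (submonoid hull F)"
  by (rule hull_in) (auto simp: submonoid_def)

text \<open>If \<open>b\<close> is a positive lower bound for \<open>w\<close> on the non-zero
  generators, a sum of \<open>k\<close> of them has value at least \<open>k * b\<close>. So only
  lists of bounded length stay below \<open>n\<close>.\<close>

lemma finite_sublevel:
  fixes w :: "'a::monoid_add \<Rightarrow> real"
  assumes "finite F" and w_zero: "w 0 = 0" and w_add: "\<And>a b. w (a + b) = w a + w b"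
    and pos: "\<And>x. x \<in> F - {0} \<Longrightarrow> 0 < w x"
  shows "finite {u \<in> submonoid hull F. w u \<le> n}"
proof -
  \<comment> \<open>The minimum of \<open>w\<close> over the non-zero generators, or 1 if there are
    none.\<close>
  obtain b where b: "0 < b" "\<And>x. x \<in> F - {0} \<Longrightarrow> b \<le> w x"
  proof (cases "F - {0} = {}")
    case False
    then have "0 < Min (w ` (F - {0}))" using assms by (subst Min_gr_iff) auto
    then show ?thesis using assms(1) by (intro that[of "Min (w ` (F - {0}))"]) auto
  qed (use that[of 1] in auto)
  have w_list: "b * length xs \<le> w (sum_list xs)" if "set xs \<subseteq> F - {0}" for xs
    using that
  proof (induction xs)
    case (Cons x xs)
    then show ?case using b(2)[of x] by (simp add: w_add algebra_simps)
  qed (simp add: w_zero)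
  have "submonoid hull F \<subseteq> sum_list ` lists (F - {0})"
  proof (rule hull_minimal)
    show "F \<subseteq> sum_list ` lists (F - {0})"
    proof
      fix x assume "x \<in> F"
      then show "x \<in> sum_list ` lists (F - {0})"
        by (intro image_eqI[of _ _ "if x = 0 then [] else [x]"]) auto
    qed
    show "submonoid (sum_list ` lists (F - {0}))"
      unfolding submonoid_def
    proof (intro conjI ballI)
      show "0 \<in> sum_list ` lists (F - {0})" by (intro image_eqI[of _ _ "[]"]) auto
      fix x y assume "x \<in> sum_list ` lists (F - {0})" "y \<in> sum_list ` lists (F - {0})"
      then obtain xs ys where "x = sum_list xs" "y = sum_list ys"
          "xs \<in> lists (F - {0})" "ys \<in> lists (F - {0})" by blast
      then show "x + y \<in> sum_list ` lists (F - {0})" by (intro image_eqI[of _ _ "xs @ ys"]) auto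
    qed
  qed
  then have "{u \<in> submonoid hull F. w u \<le> n}
      \<subseteq> sum_list ` {xs. set xs \<subseteq> F - {0} \<and> length xs \<le> nat \<lfloor>n / b\<rfloor>}"
  proof (intro subsetI)
    fix u assume sub: "submonoid hull F \<subseteq> sum_list ` lists (F - {0})"
      and "u \<in> {u \<in> submonoid hull F. w u \<le> n}"
    then have "u \<in> sum_list ` lists (F - {0})" "w u \<le> n" by auto
    then obtain xs where xs: "u = sum_list xs" "set xs \<subseteq> F - {0}" "w (sum_list xs) \<le> n"
      by (auto simp: lists_eq_set)
    then have "b * length xs \<le> n" using w_list by fastforce
    then have "real (length xs) \<le> n / b" using b(1) by (simp add: field_simps)
    then have "length xs \<le> nat \<lfloor>n / b\<rfloor>" by linarith
    with xs show "u \<in> sum_list ` {xs. set xs \<subseteq> F - {0} \<and> length xs \<le> nat \<lfloor>n / b\<rfloor>}" by blast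
  qed
  then show ?thesis
    by (rule finite_subset) (intro finite_imageI finite_lists_length_le finite_Diff assms(1))
qed

section \<open>From a vertex of the cone to a positive functional\<close>

lemma real_vec_add: "real_vec (a + b) = real_vec a + real_vec b"
  and real_vec_0 [simp]: "real_vec 0 = 0"
  by (simp_all add: real_vec_def vec_eq_iff)

lemma real_vec_eq_0 [simp]: "real_vec u = 0 \<longleftrightarrow> u = 0"
  by (simp add: real_vec_def vec_eq_iff)

lemma inner_real_vec: "real_vec v \<bullet> real_vec u = of_int (pairing v u)"
  by (simp add: real_vec_def inner_vec_def pairing_def)

text \<open>For \<open>y\<close> non-zero, the vertex \<open>x\<close> would be the midpoint of
  \<open>x + y\<close> and \<open>x - y\<close>, both in the cone.\<close>

lemma vertex_imp_pointed:
  fixes C :: "'a::real_vector set"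
  assumes "convex_cone C" "x extreme_point_of C" "y \<in> C" "- y \<in> C"
  shows "y = 0"
proof (rule ccontr)
  assume "y \<noteq> 0"
  have "x + y \<in> C" "x - y \<in> C"
    using assms convex_cone_add[of C x y] convex_cone_add[of C x "- y"]
    by (auto simp: extreme_point_of_def)
  moreover have "x \<in> open_segment (x + y) (x - y)"
    unfolding in_segment using \<open>y \<noteq> 0\<close>
    by (intro conjI exI[of _ "1/2"])
       (auto simp: algebra_simps simp flip: scaleR_add_left, simp add: eq_neg_iff_add_eq_0 flip: scaleR_2)
  ultimately show False using assms(2) by (auto simp: extreme_point_of_def)
qed

text \<open>A convex combination of \<open>K\<close> equal to 0 would put a non-zero multiple of
  some member of \<open>K\<close> and its negative into the cone. Hence 0 lies outside the compact
  hull of \<open>K\<close>, and a separating hyperplane gives \<open>a\<close>.\<close>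

lemma pointed_cone_positive_functional:
  fixes K C :: "'a::euclidean_space set"
  assumes "finite K" "0 \<notin> K" "K \<subseteq> C" "convex_cone C"
    and pointed: "\<And>y. \<lbrakk>y \<in> C; - y \<in> C\<rbrakk> \<Longrightarrow> y = 0"
  obtains a where "\<And>x. x \<in> K \<Longrightarrow> 0 < a \<bullet> x"
proof -
  have sum_in: "sum f X \<in> C" if "finite X" "\<And>x. x \<in> X \<Longrightarrow> f x \<in> C" for f :: "'a \<Rightarrow> 'a" and X
    using that assms(4)
    by (induction X rule: finite_induct) (auto simp: convex_cone_contains_0 convex_cone_add)
  have "0 \<notin> convex hull K"
  proof
    assume "0 \<in> convex hull K"
    then obtain c where c: "\<And>x. x \<in> K \<Longrightarrow> 0 \<le> c x" "sum c K = 1" "(\<Sum>x\<in>K. c x *\<^sub>R x) = 0"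
      using convex_hull_finite[OF assms(1)] by auto
    have in_C: "c x *\<^sub>R x \<in> C" if "x \<in> K" for x
      using that c(1) assms(3,4) by (auto intro: convex_cone_scaleR)
    obtain x where x: "x \<in> K" "c x \<noteq> 0" using c(2) by (metis sum.neutral zero_neq_one)
    have "c x *\<^sub>R x + (\<Sum>x\<in>K - {x}. c x *\<^sub>R x) = 0"
      using sum.remove[OF assms(1) x(1), of "\<lambda>x. c x *\<^sub>R x"] c(3) by simp
    then have "- (c x *\<^sub>R x) = (\<Sum>x\<in>K - {x}. c x *\<^sub>R x)" by (simp add: minus_unique)
    also have "\<dots> \<in> C" using assms(1) in_C by (intro sum_in) auto
    finally have "c x *\<^sub>R x = 0" using pointed in_C[OF x(1)] by blast
    then show False using x assms(2) by auto
  qed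
  moreover have "closed (convex hull K)"
    using assms(1) by (simp add: compact_imp_closed finite_imp_compact_convex_hull)
  ultimately obtain a b where "0 < b" "\<forall>x\<in>convex hull K. a \<bullet> x > b"
    using separating_hyperplane_closed_0[of "convex hull K"] by auto
  then show thesis by (intro that[of a]) (meson hull_inc order.strict_trans)
qed

lemma pointed_semigroup_exists:
  fixes \<Lambda> :: "(int ^ 'd::finite) set"
  assumes "fin_gen_submonoid \<Lambda>" "C = convex_cone hull (real_vec ` \<Lambda>)" "x extreme_point_of C"
  obtains w where "pointed_semigroup \<Lambda> w"
proof -
  obtain F where F: "finite F" "\<Lambda> = submonoid hull F"
    using assms(1) by (auto simp: fin_gen_submonoid_def)
  have C: "convex_cone C" using assms(2) by (simp add: convex_cone_convex_cone_hull)
  \<comment> \<open>Zero is removed from the generators, since no functional is positive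
    there.\<close>
  have "real_vec ` (F - {0}) \<subseteq> C"
    using F(2) hull_subset[of F submonoid] hull_subset[of "real_vec ` \<Lambda>" convex_cone] assms(2)
    by blast
  moreover have "finite (real_vec ` (F - {0}))" using F(1) by simp
  moreover have "0 \<notin> real_vec ` (F - {0})" by (auto dest: sym)
  ultimately obtain a where a: "\<And>x. x \<in> real_vec ` (F - {0}) \<Longrightarrow> 0 < a \<bullet> x"
    using C vertex_imp_pointed[OF C assms(3)] by (metis pointed_cone_positive_functional)
  let ?w = "\<lambda>u. a \<bullet> real_vec u"
  have "\<Lambda> \<subseteq> {u. 0 \<le> ?w u}"
    unfolding F(2)
  proof (rule hull_minimal)
    show "F \<subseteq> {u. 0 \<le> ?w u}"
    proof
      fix u assume "u \<in> F"
      then show "u \<in> {u. 0 \<le> ?w u}" using a[of "real_vec u"] by (cases "u = 0") auto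
    qed
  qed (auto simp: submonoid_def real_vec_add inner_add_right)
  then have "pointed_semigroup \<Lambda> ?w"
    using F(1) a unfolding F(2)
    by unfold_locales (auto simp: submonoid_hull real_vec_add inner_add_right intro!: finite_sublevel)
  then show thesis by (rule that)
qed

text \<open>By joint positivity the sum of the vectors is positive on the non-zero generators, and a
  prescribed multidegree bounds its value.\<close>

lemma jointly_positive_finite:
  assumes "fin_gen_submonoid \<Lambda>" "jointly_positive \<Lambda> vs"
    and nonneg: "\<And>v u. \<lbrakk>v \<in> set vs; u \<in> \<Lambda>\<rbrakk> \<Longrightarrow> 0 \<le> pairing v u"
  shows "finite {u \<in> \<Lambda>. mdeg vs u = a}"
proof -
  obtain F where F: "finite F" "\<Lambda> = submonoid hull F"
    using assms(1) by (auto simp: fin_gen_submonoid_def)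
  define w where "w u = real_of_int (\<Sum>v\<leftarrow>vs. pairing v u)" for u
  have "0 < w u" if u: "u \<in> F - {0}" for u
  proof -
    have "u \<in> \<Lambda>" using u F(2) hull_inc[of u F submonoid] by simp
    then obtain v where v: "v \<in> set vs" "pairing v u \<noteq> 0"
      using u assms(2) by (auto simp: jointly_positive_def)
    then have "0 < pairing v u" using nonneg[OF v(1) \<open>u \<in> \<Lambda>\<close>] by simp
    also have "pairing v u \<le> (\<Sum>v\<leftarrow>vs. pairing v u)"
      using v nonneg \<open>u \<in> \<Lambda>\<close> by (intro member_le_sum_list) auto
    finally show ?thesis by (simp add: w_def)
  qed
  then have "finite {u \<in> \<Lambda>. w u \<le> real (sum_list a)}"
    unfolding F(2) using F(1)
    by (intro finite_sublevel) (auto simp: w_def pairing_add sum_list_addf)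
  moreover have "w u \<le> real (sum_list a)" if "u \<in> \<Lambda>" "mdeg vs u = a" for u
  proof -
    have "(\<Sum>v\<leftarrow>vs. pairing v u) \<le> int (sum_list (mdeg vs u))"
      by (induction vs) (auto simp: mdeg_def)
    then have "w u \<le> of_int (int (sum_list (mdeg vs u)))"
      unfolding w_def by (simp only: of_int_le_iff)
    then show ?thesis using that by simp
  qed
  then have "{u \<in> \<Lambda>. mdeg vs u = a} \<subseteq> {u \<in> \<Lambda>. w u \<le> real (sum_list a)}" by blast
  ultimately show ?thesis by (rule rev_finite_subset)
qed

section \<open>Graded rings of sequences of monomial valuations\<close>

theorem proposition4p4:
  fixes \<Lambda> :: "(int ^ 'd::finite) set"
    and \<sigma> :: "(real ^ 'd) set"
    and R :: "(int ^ 'd \<Rightarrow> complex) ring"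
    and vs :: "(int ^ 'd) list"
  defines "\<nu>s \<equiv> map monomial_val vs"
    and "r \<equiv> length vs"
  assumes "fin_gen_submonoid \<Lambda>"
    and "{a - b |a b. a \<in> \<Lambda> \<and> b \<in> \<Lambda>} = UNIV"
    and "convex_cone \<sigma>" and "closed \<sigma>"
    and "dual_cone \<sigma> = convex_cone hull (real_vec ` \<Lambda>)"
    and "\<exists>x. x extreme_point_of (dual_cone \<sigma>)"
    and "R = semigroup_algebra \<Lambda> \<or> R = semigroup_series \<Lambda>"
    and "vs \<noteq> []"
    and "\<forall>v\<in>set vs. v \<noteq> 0 \<and> real_vec v \<in> \<sigma>"
  shows "(\<forall>k\<le>r. well_valued (gr_iter R \<nu>s k)) \<and>
         (\<forall>k<r. inj_on
            (relabelling (gr_valued (gr_iter R \<nu>s k) (vals (gr_iter R \<nu>s k) ! k))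
               :: (nat \<Rightarrow> (int ^ 'd \<Rightarrow> complex) set) \<Rightarrow> (int ^ 'd \<Rightarrow> complex))
            (carrier (gr_ring (vring (gr_iter R \<nu>s k)) (vals (gr_iter R \<nu>s k) ! k)))) \<and>
         (R = semigroup_algebra \<Lambda> \<or> jointly_positive \<Lambda> vs \<longrightarrow>
           (\<exists>\<psi> \<in> ring_iso (vring (gr_iter R \<nu>s r)) (semigroup_algebra \<Lambda>).
              (\<forall>a. length a = r \<longrightarrow> \<psi> ` hcomp (gr_iter R \<nu>s r) a = monomial_comp \<Lambda> vs a) \<and>
              (\<forall>i<r. \<forall>x\<in>carrier (vring (gr_iter R \<nu>s r)).
                 monomial_val (vs ! i) (\<psi> x) = (vals (gr_iter R \<nu>s r) ! i) x)))"
proof -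
  obtain w where "pointed_semigroup \<Lambda> w"
    using assms pointed_semigroup_exists by metis
  then interpret pointed_semigroup \<Lambda> w .
  \<comment> \<open>The vectors lie in \<sigma> and the exponents in its dual cone.\<close>
  have pairing_nonneg: "0 \<le> pairing v u" if "v \<in> set vs" "u \<in> \<Lambda>" for v u
  proof -
    have "real_vec u \<in> dual_cone \<sigma>" using assms(7) that(2) by (simp add: hull_inc)
    then have "0 \<le> real_vec v \<bullet> real_vec u"
      using assms(11) that(1) by (simp add: dual_cone_def)
    then show ?thesis by (simp add: inner_real_vec)
  qed
  then have vs: "\<forall>v\<in>set vs. nonneg v" by (simp add: nonneg_def)
  \<comment> \<open>One definition covers both rings: finiteness is demanded only for the semigroup
    algebra.\<close>
  define \<F> where "\<F> = {S. S \<subseteq> \<Lambda> \<and> (R = semigroup_algebra \<Lambda> \<longrightarrow> finite S)}"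
  interpret support_family \<Lambda> w \<F>
  proof unfold_locales
    fix S T assume "S \<in> \<F>" "T \<in> \<F>"
    moreover have "{a + b |a b. a \<in> S \<and> b \<in> T} = (\<lambda>(a, b). a + b) ` (S \<times> T)" by auto
    ultimately show "{a + b |a b. a \<in> S \<and> b \<in> T} \<in> \<F>"
      by (auto simp: \<F>_def add_in subset_eq)
  qed (auto simp: \<F>_def intro: finite_subset)
  have R: "R = (semigroup_series \<Lambda>)\<lparr>carrier := {f. supp f \<in> \<F>}\<rparr>"
  proof (cases "R = semigroup_algebra \<Lambda>")
    case True
    then show ?thesis by (auto simp: \<F>_def semigroup_algebra_def subset_eq)
  next
    case False
    then show ?thesis
      using assms(9) by (auto simp: \<F>_def semigroup_series_def subset_eq)
  qed
  note iter = represents_gr_iter[OF R vs, folded \<nu>s_def r_def]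
  have "well_valued (gr_iter R \<nu>s k)" if "k \<le> r" for k
    using iter[OF that] represents_well_valued vs by blast
  \<comment> \<open>This certifies that each \<open>transport\<close> passes to an isomorphic
    copy.\<close>
  moreover have "inj_on (relabelling (gr_valued (gr_iter R \<nu>s k) (vals (gr_iter R \<nu>s k) ! k))
               :: (nat \<Rightarrow> (int ^ 'd \<Rightarrow> complex) set) \<Rightarrow> (int ^ 'd \<Rightarrow> complex))
            (carrier (gr_ring (vring (gr_iter R \<nu>s k)) (vals (gr_iter R \<nu>s k) ! k)))" if k: "k < r" for k
  proof -
    from iter[OF less_imp_le[OF k]]
    obtain \<phi> where \<phi>: "represents (take k vs) vs (gr_iter R \<nu>s k) \<phi>" ..
    obtain \<psi> where "represents (take k vs @ [vs ! k]) vs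
        (gr_valued (gr_iter R \<nu>s k) (vals (gr_iter R \<nu>s k) ! k)) \<psi>"
      by (rule represents_gr_valued[OF \<phi> vs]) (use k in \<open>simp add: r_def\<close>)
    from inj_on_relabelling[OF this] show ?thesis by (simp add: gr_valued_def)
  qed
  moreover have "\<exists>\<psi> \<in> ring_iso (vring (gr_iter R \<nu>s r)) (semigroup_algebra \<Lambda>).
              (\<forall>a. length a = r \<longrightarrow> \<psi> ` hcomp (gr_iter R \<nu>s r) a = monomial_comp \<Lambda> vs a) \<and>
              (\<forall>i<r. \<forall>x\<in>carrier (vring (gr_iter R \<nu>s r)).
                 monomial_val (vs ! i) (\<psi> x) = (vals (gr_iter R \<nu>s r) ! i) x)"
    if pos: "R = semigroup_algebra \<Lambda> \<or> jointly_positive \<Lambda> vs"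
  proof -
    \<comment> \<open>After all \<open>r\<close> steps the representation by coefficient functions
      is the desired isomorphism.\<close>
    from iter[OF order_refl]
    obtain \<psi> where \<psi>: "represents vs vs (gr_iter R \<nu>s r) \<psi>" unfolding r_def take_all[OF order_refl] ..
    interpret represented \<Lambda> w \<F> vs "vring (gr_iter R \<nu>s r)" "hcomp (gr_iter R \<nu>s r)" \<psi>
      using \<psi> by (simp add: represents_def)
    \<comment> \<open>For power series, joint positivity makes each multidegree class of \<Lambda>
      finite, and only finitely many multidegrees occur; for the algebra, finiteness is built into
      \<F>.\<close>
    have fin_supp: "finite (supp f)" if "supp f \<in> \<F>" "finite (mdeg vs ` supp f)" for f
    proof (cases "R = semigroup_algebra \<Lambda>")
      case False
      with pos have "jointly_positive \<Lambda> vs" by blast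
      note fin = jointly_positive_finite[OF assms(3) this pairing_nonneg]
      have "finite (supp f \<inter> mdeg vs -` {a})" for a
        by (rule finite_subset[OF _ fin[of a]]) (use that(1) in \<open>auto simp: \<F>_def\<close>)
      then have "finite (\<Union>a\<in>mdeg vs ` supp f. supp f \<inter> mdeg vs -` {a})"
        using that(2) by blast
      then show ?thesis by (rule rev_finite_subset) auto
    qed (use that in \<open>simp add: \<F>_def\<close>)
    have fns: "fns vs = carrier (semigroup_algebra \<Lambda>)"
    proof (intro subset_antisym subsetI)
      fix f assume "f \<in> fns vs"
      then have "finite (supp f)" "supp f \<subseteq> \<Lambda>"
        using fin_supp[of f] fns_supp by (auto simp: fns_def)
      then show "f \<in> carrier (semigroup_algebra \<Lambda>)" by (auto simp: semigroup_algebra_def)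
    next
      fix f assume "f \<in> carrier (semigroup_algebra \<Lambda>)"
      then have "finite (supp f)" "supp f \<subseteq> \<Lambda>" by (auto simp: semigroup_algebra_def)
      moreover from this have "supp f \<in> \<F>" unfolding \<F>_def by blast
      ultimately show "f \<in> fns vs" by (simp add: fns_def)
    qed
    have iso: "\<psi> \<in> ring_iso (vring (gr_iter R \<nu>s r)) (semigroup_algebra \<Lambda>)"
      using bij hom unfolding fns
      by (auto simp: ring_iso_def ring_hom_def bij_betw_def semigroup_algebra_def semigroup_series_def)
    have "\<psi> ` hcomp (gr_iter R \<nu>s r) a = monomial_comp \<Lambda> vs a" if a: "length a = r" for a
    proof -
      \<comment> \<open>The integer degrees in \<open>monomial_comp\<close> are non-negative on
        \<Lambda>, hence agree with \<open>mdeg\<close>.\<close>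
      have "map (\<lambda>v. pairing v u) vs = map int a \<longleftrightarrow> mdeg vs u = a" if "u \<in> \<Lambda>" for u
      proof -
        have "map (\<lambda>v. pairing v u) vs = map int (mdeg vs u)"
          using pairing_nonneg that by (simp add: mdeg_def)
        then show ?thesis by (simp add: inj_map_eq_map)
      qed
      then have "monomial_comp \<Lambda> vs a = {f \<in> fns vs. \<forall>u. f u \<noteq> 0 \<longrightarrow> mdeg vs u = a}"
        unfolding monomial_comp_def fns[symmetric] using fns_in by blast
      also have "\<dots> = \<psi> ` hcomp (gr_iter R \<nu>s r) a"
        unfolding bij_betw_imp_surj_on[OF bij, symmetric] comp[OF a[unfolded r_def]] by blast
      finally show ?thesis ..
    qed
    then show ?thesis
      using iso \<psi> by (intro bexI[of _ \<psi>]) (auto simp: represents_def r_def)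
  qed
  ultimately show ?thesis by blast
qed

end
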